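(* (i) Let $r\ge 3$ be such that $r-1$ is a prime power. Then there exists a nice $r$-uniform hypergraph that is not strongly $(r^2-r)$-weighted. Furthermore, there is a function $g:\mathbb{N}\to\mathbb{N}$ with $g(r)/r^2\to 0$ as $r\to\infty$ such that for all sufficiently large $r$ there exists a nice $r$-uniform hypergraph that is not strongly $(r^2-g(r))$-weighted. (ii) Let $r\ge 3$. Then there exists an $r$-uniform hypergraph that is not weakly $2$-weighted.
   Context: An $r$-uniform hypergraph $H=(V,E)$ has every edge of size $r$. Given a weight function $\omega:E\to\{1,\dots,w\}$, the induced vertex-coloring is $c(v)=\sum_{e\ni v}\omega(e)$ for $v\in V$. The coloring is weak if no edge is monochromatic, and strong if every edge is rainbow (for each edge $\{v_1,\dots,v_r\}$, $c(v_i)\ne c(v_j)$ for all $i\ne j$). $H$ is weakly (resp. strongly) $w$-weighted if there exists $\omega:E\to\{1,\dots,w\}$ whose induced coloring is weak (resp. strong). A hypergraph is nice if there is no pair of distinct vertices $u,v$ such that the set of edges containing $u$ equals the set of edges containing $v$. *)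

theory Defs
  imports Complex_Main "HOL-Number_Theory.Prime_Powers"
begin

definition uniform_hypergraph :: "nat \<Rightarrow> 'a set \<Rightarrow> 'a set set \<Rightarrow> bool" where
  "uniform_hypergraph r V E \<longleftrightarrow> finite V \<and> (\<forall>e\<in>E. e \<subseteq> V \<and> card e = r)"

definition induced_colour :: "'a set set \<Rightarrow> ('a set \<Rightarrow> nat) \<Rightarrow> 'a \<Rightarrow> nat" where
  "induced_colour E \<omega> v = (\<Sum>e\<in>{e\<in>E. v \<in> e}. \<omega> e)"

definition weighting :: "nat \<Rightarrow> 'a set set \<Rightarrow> ('a set \<Rightarrow> nat) \<Rightarrow> bool" where
  "weighting w E \<omega> \<longleftrightarrow> (\<forall>e\<in>E. 1 \<le> \<omega> e \<and> \<omega> e \<le> w)"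

definition weak_colouring :: "'a set set \<Rightarrow> ('a \<Rightarrow> nat) \<Rightarrow> bool" where
  "weak_colouring E c \<longleftrightarrow> (\<forall>e\<in>E. \<exists>u\<in>e. \<exists>v\<in>e. c u \<noteq> c v)"

definition strong_colouring :: "'a set set \<Rightarrow> ('a \<Rightarrow> nat) \<Rightarrow> bool" where
  "strong_colouring E c \<longleftrightarrow> (\<forall>e\<in>E. \<forall>u\<in>e. \<forall>v\<in>e. u \<noteq> v \<longrightarrow> c u \<noteq> c v)"

definition weakly_weighted :: "nat \<Rightarrow> 'a set set \<Rightarrow> bool" where
  "weakly_weighted w E \<longleftrightarrow> (\<exists>\<omega>. weighting w E \<omega> \<and> weak_colouring E (induced_colour E \<omega>))"

definition strongly_weighted :: "nat \<Rightarrow> 'a set set \<Rightarrow> bool" where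
  "strongly_weighted w E \<longleftrightarrow> (\<exists>\<omega>. weighting w E \<omega> \<and> strong_colouring E (induced_colour E \<omega>))"

definition nice :: "'a set \<Rightarrow> 'a set set \<Rightarrow> bool" where
  "nice V E \<longleftrightarrow> (\<forall>u\<in>V. \<forall>v\<in>V. u \<noteq> v \<longrightarrow> {e\<in>E. u \<in> e} \<noteq> {e\<in>E. v \<in> e})"

end

(*
  Take an r-regular graph and pass to its dual: the vertices of the hypergraph are the edges of the
  graph, its hyperedges are the stars of the vertices. The colour of the graph edge uv is then
  w(u) + w(v), so a strong colouring forces w to be injective on every neighbourhood. Hence if P is a
  set of vertices any two of which have a common neighbour, card P weights are necessary.

  If r - 1 is a prime power, the incidence graph of a projective plane of order r - 1 gives
  card P = r^2 - r + 1. For general r, take the n^2 points of the affine plane over the ring Z/n with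
  n = p^i q^j slightly below r, where p, q are fixed large primes: the lines y = m x + c join all but a
  small proportion of the pairs of points, the remaining pairs are joined by few additional blocks, and
  such n are dense enough because ln p / ln q is irrational. In (ii) a single edge suffices: its vertices
  all receive the same colour.
*)
theory Submission
  imports Defs "HOL-Number_Theory.Number_Theory" "HOL-Analysis.Kronecker_Approximation_Theorem"
    "HOL-Real_Asymp.Real_Asymp" "Jordan_Normal_Form.Char_Poly"
begin

text \<open>For general r, a plane over a field would need prime powers q with q/r close to 1 and
  thus rely on short gaps between primes. The powers of one fixed prime leave gaps of constant
  ratio, but products of powers of two fixed primes do not. The price is zero divisors: about a
  proportion 1/p + 1/q of the differences of abscissas are non-units, so p and q are chosen large
  before r grows. Each choice of p and q reaches only (1 - \<epsilon>) r^2; a minimal choice of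
  \<open>g\<close> merges all \<epsilon>. The patched incidence structure is irregular, so the dual
  construction is extended to graphs of degree at most r. For the projective plane only the lines y
  = m x + c on the index set \<open>{..<q}\<close> matter, so the finite field can remain a system
  of congruence classes.\<close>

section \<open>Hypergraphs dual to graphs\<close>

text \<open>The dual has sets of graph vertices as its vertices, whereas the theorem speaks of
  \<open>nat\<close>. All notions are invariant under relabelling; a weighting of the image is
  pulled back along \<open>f\<close>.\<close>

lemma nice_uniform_to_nat:
  fixes V :: "'a set"
  assumes u: "uniform_hypergraph r V E" and n: "nice V E" and s: "\<not> strongly_weighted w E"
  shows "\<exists>(V'::nat set) E'. uniform_hypergraph r V' E' \<and> nice V' E' \<and> \<not> strongly_weighted w E'"
proof -
  have fin: "finite V" and EV: "\<And>e. e \<in> E \<Longrightarrow> e \<subseteq> V" and cE: "\<And>e. e \<in> E \<Longrightarrow> card e = r"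
    using u by (auto simp: uniform_hypergraph_def)
  obtain f :: "'a \<Rightarrow> nat" where f: "inj_on f V"
    using finite_imp_inj_to_nat_seg[OF fin] by blast
  define E' where "E' = (`) f ` E"
  have mem: "f v \<in> f ` e \<longleftrightarrow> v \<in> e" if "v \<in> V" "e \<in> E" for v e
    using inj_on_image_mem_iff[OF f] that EV by blast
  have inj: "inj_on ((`) f) E"
    using inj_on_image_eq_iff[OF f] EV by (auto simp: inj_on_def)
  have star: "{e' \<in> E'. f v \<in> e'} = (`) f ` {e \<in> E. v \<in> e}" if "v \<in> V" for v
    using mem[OF that] by (auto simp: E'_def)
  have "uniform_hypergraph r (f ` V) E'"
    unfolding uniform_hypergraph_def E'_def
    using fin EV cE by (auto simp: card_image[OF inj_on_subset[OF f]])
  moreover have "nice (f ` V) E'"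
    unfolding nice_def
  proof (intro ballI impI)
    fix a b assume "a \<in> f ` V" "b \<in> f ` V" "a \<noteq> b"
    then obtain u v where uv: "u \<in> V" "v \<in> V" "a = f u" "b = f v" "u \<noteq> v" by blast
    have "{e \<in> E. u \<in> e} \<noteq> {e \<in> E. v \<in> e}" using n uv by (auto simp: nice_def)
    then show "{e \<in> E'. a \<in> e} \<noteq> {e \<in> E'. b \<in> e}"
      unfolding uv(3,4) star[OF uv(1)] star[OF uv(2)]
      using inj_on_image_eq_iff[OF inj, of "{e \<in> E. u \<in> e}" "{e \<in> E. v \<in> e}"] by blast
  qed
  moreover have "\<not> strongly_weighted w E'"
  proof
    assume "strongly_weighted w E'"
    then obtain \<omega> where w: "weighting w E' \<omega>" and c: "strong_colouring E' (induced_colour E' \<omega>)"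
      by (auto simp: strongly_weighted_def)
    define \<omega>' where "\<omega>' e = \<omega> (f ` e)" for e
    have col: "induced_colour E' \<omega> (f v) = induced_colour E \<omega>' v" if "v \<in> V" for v
      unfolding induced_colour_def star[OF that] \<omega>'_def
      by (subst sum.reindex) (auto intro: inj_on_subset[OF inj])
    have "weighting w E \<omega>'" using w by (auto simp: weighting_def \<omega>'_def E'_def)
    moreover have "strong_colouring E (induced_colour E \<omega>')"
      unfolding strong_colouring_def
    proof (intro ballI impI)
      fix e u v assume e: "e \<in> E" "u \<in> e" "v \<in> e" "u \<noteq> v"
      then have V: "u \<in> V" "v \<in> V" using EV by auto
      then have "f u \<noteq> f v" using f e(4) by (auto simp: inj_on_def)
      moreover have "f ` e \<in> E'" using e by (auto simp: E'_def)
      ultimately have "induced_colour E' \<omega> (f u) \<noteq> induced_colour E' \<omega> (f v)"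
        using c[unfolded strong_colouring_def, rule_format, of "f ` e" "f u" "f v"] e(2,3) by simp
      then show "induced_colour E \<omega>' u \<noteq> induced_colour E \<omega>' v" using col V by simp
    qed
    ultimately show False using s by (auto simp: strongly_weighted_def)
  qed
  ultimately show ?thesis by blast
qed

text \<open>A graph edge lies in exactly the stars of its two ends and, as \<open>star\<close> is
  injective, can be recovered from them. This gives niceness.\<close>

lemma regular_graph_dual:
  fixes W :: "'a set"
  assumes finW: "finite W" and sym: "\<And>u v. u \<in> N v \<Longrightarrow> v \<in> N u" and irr: "\<And>v. v \<notin> N v"
    and NW: "\<And>v. N v \<subseteq> W" and reg: "\<And>v. v \<in> W \<Longrightarrow> card (N v) = r" and r: "r \<ge> 2"
    and P: "P \<subseteq> W" and cn: "\<And>u u'. u \<in> P \<Longrightarrow> u' \<in> P \<Longrightarrow> u \<noteq> u' \<Longrightarrow> \<exists>v. u \<in> N v \<and> u' \<in> N v"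
    and w: "w < card P"
  shows "\<exists>(V::nat set) E. uniform_hypergraph r V E \<and> nice V E \<and> \<not> strongly_weighted w E"
proof -
  define star where "star v = (\<lambda>u. {u, v}) ` N v" for v
  define V where "V = (\<Union>v\<in>W. star v)"
  define E where "E = star ` W"
  have finN: "finite (N v)" for v using finW NW finite_subset by blast
  have star_iff: "x \<in> star c \<longleftrightarrow> c \<in> x" if "x = {a, b}" "a \<in> N b" for x a b c
    using that sym[OF that(2)] irr by (auto simp: star_def doubleton_eq_iff)
  have Vform: "\<exists>a b. x = {a, b} \<and> a \<in> N b \<and> b \<in> N a \<and> a \<in> W \<and> b \<in> W \<and> a \<noteq> b" if "x \<in> V" for x
    using that irr sym NW unfolding V_def star_def by blast
  have inj: "inj_on star W"
  proof (rule inj_onI, rule ccontr)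
    fix v v' assume v: "v \<in> W" "v' \<in> W" "star v = star v'" "v \<noteq> v'"
    \<comment> \<open>Every edge at v also contains v', so v' is the only possible neighbour of v;
      degree r \<ge> 2 excludes this.\<close>
    have "N v \<subseteq> {v'}"
    proof
      fix u assume u: "u \<in> N v"
      then have "{u, v} \<in> star v'" using v(3) by (auto simp: star_def)
      then show "u \<in> {v'}" using star_iff[OF refl u] v(4) by auto
    qed
    then have "card (N v) \<le> 1" using card_mono[of "{v'}"] by fastforce
    then show False using reg v r by fastforce
  qed
  have edges_at: "{e \<in> E. x \<in> e} = star ` x" if x: "x \<in> V" for x
  proof -
    obtain a b where ab: "x = {a, b}" "a \<in> N b" "a \<in> W" "b \<in> W" using Vform[OF x] by blast
    show ?thesis using star_iff[OF ab(1,2)] ab by (auto simp: E_def)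
  qed
  have inj2: "inj_on (\<lambda>u. {u, v}) (N v)" for v by (auto simp: inj_on_def doubleton_eq_iff)
  have "uniform_hypergraph r V E"
    unfolding uniform_hypergraph_def
    using finW finN reg by (auto simp: V_def E_def star_def card_image inj2)
  moreover have "nice V E"
    unfolding nice_def
  proof (intro ballI impI)
    fix x y assume xy: "x \<in> V" "y \<in> V" "x \<noteq> y"
    have "x \<subseteq> W" using Vform[OF xy(1)] by auto
    moreover have "y \<subseteq> W" using Vform[OF xy(2)] by auto
    ultimately have "star ` x \<noteq> star ` y" using inj_on_image_eq_iff[OF inj] xy(3) by simp
    then show "{e \<in> E. x \<in> e} \<noteq> {e \<in> E. y \<in> e}"
      by (simp only: edges_at[OF xy(1)] edges_at[OF xy(2)] not_False_eq_True)
  qed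
  moreover have "\<not> strongly_weighted w E"
  proof
    assume "strongly_weighted w E"
    then obtain \<omega> where wt: "weighting w E \<omega>" and c: "strong_colouring E (induced_colour E \<omega>)"
      by (auto simp: strongly_weighted_def)
    have col: "induced_colour E \<omega> {a, b} = \<omega> (star a) + \<omega> (star b)" if "a \<in> N b" for a b
    proof -
      have ab: "a \<in> W" "b \<in> W" "a \<noteq> b"
        using that NW[of b] NW[of a] sym[OF that] irr[of b] by auto
      have "{a, b} \<in> V" using ab that by (auto simp: V_def star_def)
      moreover have "star a \<noteq> star b" using inj ab by (auto simp: inj_on_def)
      ultimately show ?thesis unfolding induced_colour_def edges_at[OF \<open>{a, b} \<in> V\<close>] by simp
    qed
    have "inj_on (\<omega> \<circ> star) P"
    proof (rule inj_onI, rule ccontr)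
      fix u u' assume u: "u \<in> P" "u' \<in> P" "(\<omega> \<circ> star) u = (\<omega> \<circ> star) u'" "u \<noteq> u'"
      then obtain v where v: "u \<in> N v" "u' \<in> N v" using cn by blast
      then have "v \<in> W" using sym[OF v(1)] NW[of u] by auto
      then have "star v \<in> E" by (simp add: E_def)
      moreover have "{u, v} \<in> star v" "{u', v} \<in> star v" "{u, v} \<noteq> {u', v}"
        using v u by (auto simp: star_def doubleton_eq_iff)
      ultimately show False
        using c col[OF v(1)] col[OF v(2)] u(3) unfolding strong_colouring_def by fastforce
    qed
    moreover have "(\<omega> \<circ> star) ` P \<subseteq> {1..w}"
      using wt P by (auto simp: weighting_def E_def)
    ultimately have "card P \<le> card {1..w}" using card_inj_on_le by blast
    then show False using w by simp
  qed
  ultimately show ?thesis using nice_uniform_to_nat by blast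
qed

text \<open>Regularisation: on copies of the graph indexed by the vertices of the \<open>r\<close>-cube, the deficiency of
  \<open>v\<close> is made up by cube edges in the first \<open>r - card (N v)\<close> directions.\<close>

lemma bounded_degree_graph_dual:
  fixes W :: "'a set"
  assumes finW: "finite W" and sym: "\<And>u v. u \<in> N v \<Longrightarrow> v \<in> N u" and irr: "\<And>v. v \<notin> N v"
    and NW: "\<And>v. N v \<subseteq> W" and deg: "\<And>v. v \<in> W \<Longrightarrow> card (N v) \<le> r" and r: "r \<ge> 2"
    and P: "P \<subseteq> W" and cn: "\<And>u u'. u \<in> P \<Longrightarrow> u' \<in> P \<Longrightarrow> u \<noteq> u' \<Longrightarrow> \<exists>v. u \<in> N v \<and> u' \<in> N v"
    and w: "w < card P"
  shows "\<exists>(V::nat set) E. uniform_hypergraph r V E \<and> nice V E \<and> \<not> strongly_weighted w E"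
proof -
  define flip where "flip i S = (if i \<in> S then S - {i} else insert i S)" for i :: nat and S
  have flip_flip: "flip i (flip i S) = S" for i S by (auto simp: flip_def)
  have flip_ne: "flip i S \<noteq> S" for i S by (auto simp: flip_def)
  have flip_inj: "inj_on (\<lambda>i. flip i S) A" for S A
    by (rule inj_onI) (auto simp: flip_def split: if_splits)
  define W' where "W' = W \<times> Pow {..<r}"
  define C where "C x = (\<lambda>i. (fst x, flip i (snd x))) ` {..<r - card (N (fst x))}" for x :: "'a \<times> nat set"
  define N' where "N' x = (if x \<in> W' then N (fst x) \<times> {snd x} \<union> C x else {})" for x
  have C_sub: "C x \<subseteq> W'" if "x \<in> W'" for x
    using that by (auto simp: C_def W'_def flip_def split: if_splits)
  have N'W: "N' x \<subseteq> W'" for x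
    using C_sub[of x] NW by (auto simp: N'_def W'_def)
  \<comment> \<open>A flip is an involution and keeps the first coordinate, which alone determines
    the deficiency. So both ends use the same directions.\<close>
  have symC: "x \<in> C y" if y: "y \<in> C x" for x y
  proof -
    obtain i where i: "i < r - card (N (fst x))" "y = (fst x, flip i (snd x))"
      using y by (auto simp: C_def)
    then have "x = (fst y, flip i (snd y))" by (simp add: flip_flip)
    then show ?thesis using i unfolding C_def by force
  qed
  \<comment> \<open>\<open>P\<close> is placed in the copy indexed by the empty set; common
    neighbours survive inside a single copy.\<close>
  show ?thesis
  proof (rule regular_graph_dual[where W = W' and N = N' and P = "P \<times> {{}}"])
    show "finite W'" using finW by (simp add: W'_def)
    show "N' v \<subseteq> W'" for v by (rule N'W)
    show "v \<in> N' u" if "u \<in> N' v" for u v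
    proof -
      have "u \<in> W'" using that N'W by blast
      then show ?thesis
        using that sym[of "fst u" "fst v"] symC[of u v]
        by (cases u; cases v) (auto simp: N'_def split: if_splits)
    qed
    show "v \<notin> N' v" for v
      using irr flip_ne by (cases v) (auto simp: N'_def C_def dest: sym)
    show "card (N' x) = r" if x: "x \<in> W'" for x
    proof -
      have fN: "finite (N (fst x))" using finW NW finite_subset by blast
      have "card (C x) = r - card (N (fst x))"
        unfolding C_def using flip_inj[of "snd x"] by (subst card_image) (simp_all add: inj_on_def)
      moreover have "(N (fst x) \<times> {snd x}) \<inter> C x = {}" using irr by (auto simp: C_def)
      moreover have "finite (C x)" by (simp add: C_def)
      moreover have "card (N (fst x)) \<le> r" using deg x by (auto simp: W'_def)
      ultimately show ?thesis using x fN by (simp add: N'_def card_Un_disjoint)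
    qed
    show "2 \<le> r" by (rule r)
    show "P \<times> {{}} \<subseteq> W'" using P by (auto simp: W'_def)
    show "\<exists>v. u \<in> N' v \<and> u' \<in> N' v" if u: "u \<in> P \<times> {{}}" "u' \<in> P \<times> {{}}" "u \<noteq> u'" for u u'
    proof -
      obtain a b where ab: "u = (a, {})" "u' = (b, {})" "a \<in> P" "b \<in> P" "a \<noteq> b" using u by auto
      then obtain v where v: "a \<in> N v" "b \<in> N v" using cn by blast
      then have "v \<in> W" using sym NW by blast
      then have "u \<in> N' (v, {}) \<and> u' \<in> N' (v, {})" using v ab by (auto simp: N'_def W'_def)
      then show ?thesis by blast
    qed
    show "w < card (P \<times> {{}})" using w by (simp add: card_cartesian_product)
  qed
qed

text \<open>In the bipartite incidence graph a block through two points is their common neighbour.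
  Both kinds of planes enter the argument through this form.\<close>

lemma pairwise_incident_hypergraph:
  fixes P :: "'p set" and B :: "'b set" and J :: "'p \<Rightarrow> 'b \<Rightarrow> bool"
  assumes fin: "finite P" "finite B" and r: "r \<ge> 2"
    and degP: "\<And>p. p \<in> P \<Longrightarrow> card {b \<in> B. J p b} \<le> r"
    and degB: "\<And>b. b \<in> B \<Longrightarrow> card {p \<in> P. J p b} \<le> r"
    and cover: "\<And>p p'. p \<in> P \<Longrightarrow> p' \<in> P \<Longrightarrow> p \<noteq> p' \<Longrightarrow> \<exists>b\<in>B. J p b \<and> J p' b"
    and w: "w < card P"
  shows "\<exists>(V::nat set) E. uniform_hypergraph r V E \<and> nice V E \<and> \<not> strongly_weighted w E"
proof -
  define N :: "'p + 'b \<Rightarrow> ('p + 'b) set" where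
    "N v = (case v of Inl p \<Rightarrow> Inr ` {b \<in> B. p \<in> P \<and> J p b} | Inr b \<Rightarrow> Inl ` {p \<in> P. b \<in> B \<and> J p b})" for v
  show ?thesis
  proof (rule bounded_degree_graph_dual[where W = "P <+> B" and N = N and P = "Inl ` P"])
    show "card (N v) \<le> r" if "v \<in> P <+> B" for v
      using that degP degB by (auto simp: N_def card_image)
    show "\<exists>v. u \<in> N v \<and> u' \<in> N v" if u: "u \<in> Inl ` P" "u' \<in> Inl ` P" "u \<noteq> u'" for u u'
    proof -
      obtain p p' where p: "u = Inl p" "u' = Inl p'" "p \<in> P" "p' \<in> P" "p \<noteq> p'" using u by auto
      then obtain b where "b \<in> B" "J p b" "J p' b" using cover by blast
      then have "u \<in> N (Inr b) \<and> u' \<in> N (Inr b)" using p by (auto simp: N_def)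
      then show ?thesis by blast
    qed
  qed (use fin r w in \<open>auto simp: N_def card_image split: sum.splits\<close>)
qed

lemma single_edge_not_weakly_weighted:
  "\<exists>(V::nat set) E. uniform_hypergraph r V E \<and> \<not> weakly_weighted k E"
proof (intro exI conjI)
  show "uniform_hypergraph r {..<r} {{..<r}}" by (simp add: uniform_hypergraph_def)
  show "\<not> weakly_weighted k {{..<r}}"
    by (auto simp: weakly_weighted_def weak_colouring_def induced_colour_def Collect_conv_if)
qed

section \<open>The affine plane over the integers modulo n\<close>

lemma card_parity_class_le:
  "card {y. y < n \<and> y mod 2 = h} \<le> (n + 1) div (2::nat)"
proof -
  have "inj_on (\<lambda>y. y div 2) {y. y < n \<and> y mod 2 = h}"
  proof (rule inj_onI)
    fix y z assume "y \<in> {y. y < n \<and> y mod 2 = h}" "z \<in> {y. y < n \<and> y mod 2 = h}" "y div 2 = z div 2"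
    then show "y = z" using div_mult_mod_eq[of y 2] div_mult_mod_eq[of z 2] by simp
  qed
  moreover have "(\<lambda>y. y div 2) ` {y. y < n \<and> y mod 2 = h} \<subseteq> {..<(n + 1) div 2}"
    by auto
  ultimately have "card {y. y < n \<and> y mod 2 = h} \<le> card {..<(n + 1) div 2}"
    by (rule card_inj_on_le) simp
  then show ?thesis by simp
qed

text \<open>The slope is (y - y') t, where t inverts the unit x - x' modulo n. Slope and intercept
  are computed in the integers, where differences make sense, and then reduced.\<close>

lemma line_mod_through_two_points:
  fixes n x x' y y' :: nat
  assumes n: "n > 0" and cop: "coprime (int x - int x') (int n)" and y: "y < n" "y' < n"
  shows "\<exists>m<n. \<exists>c<n. y = (m * x + c) mod n \<and> y' = (m * x' + c) mod n"
proof -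
  obtain t where t: "[(int x - int x') * t = 1] (mod int n)"
    using cong_solve_coprime_int[OF cop] by blast
  define m0 where "m0 = t * (int y - int y')"
  define c0 where "c0 = int y - m0 * int x"
  define m where "m = nat (m0 mod int n)"
  define c where "c = nat (c0 mod int n)"
  have im: "int m = m0 mod int n" and ic: "int c = c0 mod int n" using n by (auto simp: m_def c_def)
  have "m < n" "c < n" using n im ic by (metis of_nat_0_less_iff of_nat_less_iff pos_mod_bound)+
  have val: "int ((m * z + c) mod n) = (m0 * int z + c0) mod int n" for z
    proof -
    have "int ((m * z + c) mod n) = ((m0 mod int n) * int z + c0 mod int n) mod int n"
      by (simp only: of_nat_mod of_nat_add of_nat_mult im ic)
    also have "\<dots> = (m0 * int z + c0) mod int n"
      unfolding unique_euclidean_semiring_class.cong_def[symmetric] by (intro cong_add cong_mult) (simp_all add: unique_euclidean_semiring_class.cong_def)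
    finally show ?thesis .
  qed
  have "int ((m * x + c) mod n) = int y" unfolding val using y by (simp add: c0_def)
  moreover have "int ((m * x' + c) mod n) = int y'"
  proof -
    have "[((int x - int x') * t) * (int y' - int y) = 1 * (int y' - int y)] (mod int n)"
      by (rule cong_mult[OF t cong_refl])
    then have "[int y + ((int x - int x') * t) * (int y' - int y) = int y + 1 * (int y' - int y)] (mod int n)"
      by (rule cong_add[OF cong_refl])
    moreover have "m0 * int x' + c0 = int y + ((int x - int x') * t) * (int y' - int y)"
      by (simp add: m0_def c0_def algebra_simps)
    ultimately show ?thesis unfolding val using y by (simp add: unique_euclidean_semiring_class.cong_def)
  qed
  ultimately have "y = (m * x + c) mod n \<and> y' = (m * x' + c) mod n"
    by (simp only: of_nat_eq_iff)
  then show ?thesis using \<open>m < n\<close> \<open>c < n\<close> by blast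
qed

text \<open>The points are those of the affine plane over \<open>\<int>/n\<close>. Lines \<open>y = m x + c\<close> join two points unless
  the difference of their abscissas is a non-unit; those pairs are covered by unions of two half-columns,
  a half-column being given by the abscissa and the parity of the ordinate.\<close>

lemma affine_mod_hypergraph:
  fixes n D r w :: nat
  assumes n: "n \<ge> 2" and r: "n + 4 * D \<le> r" and w: "w < n^2"
    and D: "\<And>x. x < n \<Longrightarrow> card {x'. x' < n \<and> \<not> coprime (int x - int x') (int n)} \<le> D"
  shows "\<exists>(V::nat set) E. uniform_hypergraph r V E \<and> nice V E \<and> \<not> strongly_weighted w E"
proof -
  define bad where "bad x x' \<longleftrightarrow> \<not> coprime (int x - int x') (int n)" for x x' :: nat
  have bad_sym: "bad x x' \<longleftrightarrow> bad x' x" for x x'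
    unfolding bad_def by (metis coprime_minus_left_iff minus_diff_eq)
  \<comment> \<open>The difference 0 is itself a non-unit. The resulting D \<ge> 1 pays for the
    rounding in the size of two half-columns.\<close>
  have "card {0::nat} \<le> card {x'. x' < n \<and> \<not> coprime (int 0 - int x') (int n)}"
    using n by (intro card_mono) auto
  also have "\<dots> \<le> D" using D[of 0] n by (simp only:)
  finally have D1: "D \<ge> 1" by simp
  define P where "P = {..<n} \<times> {..<n}"
  \<comment> \<open>Two whole columns would make a block of 2n points, too many for r; two halves
    have at most n + 1.\<close>
  define half where "half p = (fst p, snd p mod 2)" for p :: "nat \<times> nat"
  \<comment> \<open>Equal abscissas are bad too, so these blocks also join points on a vertical
    line, even within one half-column.\<close>
  define pairs where "pairs = {(k, k'). k \<in> {..<n} \<times> {..<2::nat} \<and> k' \<in> {..<n} \<times> {..<2::nat} \<and> bad (fst k) (fst k')}"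
  define B where "B = P <+> pairs"
  define J where "J p b = (case b of Inl l \<Rightarrow> snd p = (fst l * fst p + snd l) mod n
     | Inr kk \<Rightarrow> half p = fst kk \<or> half p = snd kk)" for p :: "nat \<times> nat" and b
  show ?thesis
  proof (rule pairwise_incident_hypergraph[where P = P and B = B and J = J])
    have "pairs \<subseteq> ({..<n} \<times> {..<2}) \<times> ({..<n} \<times> {..<2})" by (auto simp: pairs_def)
    then have "finite pairs" by (rule finite_subset) auto
    then show "finite P" "finite B" by (auto simp: P_def B_def)
    show "2 \<le> r" using n r by simp
    show "w < card P" using w by (simp add: P_def card_cartesian_product power2_eq_square)
    show "card {b \<in> B. J p b} \<le> r" if "p \<in> P" for p
    proof -
      define x where "x = fst p"
      have x: "x < n" using that by (auto simp: P_def x_def)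
      define A where "A = {l \<in> P. snd p = (fst l * x + snd l) mod n}"
      \<comment> \<open>The at most 2D half-columns that are bad for x. Each occurs in both orders
        in \<open>pairs\<close>, whence the 4D; the n comes from one line per slope.\<close>
      define T where "T = {x'. x' < n \<and> bad x x'} \<times> {..<2::nat}"
      have "finite T" by (simp add: T_def)
      have cT: "card T \<le> 2 * D"
        using D[OF x] by (simp add: T_def card_cartesian_product bad_def)
      have "inj_on fst A"
      proof (rule inj_onI)
        fix l l' assume l: "l \<in> A" "l' \<in> A" "fst l = fst l'"
        then have "[fst l * x + snd l = fst l * x + snd l'] (mod n)" by (simp add: A_def unique_euclidean_semiring_class.cong_def)
        then have "[snd l = snd l'] (mod n)" by (simp add: cong_add_lcancel_nat)
        then have "snd l = snd l'" using l by (auto simp: A_def P_def unique_euclidean_semiring_class.cong_def)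
        then show "l = l'" using l(3) by (simp add: prod_eq_iff)
      qed
      moreover have "fst ` A \<subseteq> {..<n}" by (auto simp: A_def P_def)
      ultimately have cA: "card A \<le> n" using card_inj_on_le[of fst A "{..<n}"] by simp
      have fA: "finite A" by (simp add: A_def P_def)
      have "{b \<in> B. J p b} \<subseteq> Inl ` A \<union> Inr ` ({half p} \<times> T \<union> T \<times> {half p})" (is "_ \<subseteq> ?R")
        using bad_sym by (auto simp: B_def J_def A_def x_def T_def pairs_def half_def)
      moreover have "finite ?R" using fA \<open>finite T\<close> by simp
      ultimately have "card {b \<in> B. J p b} \<le> card ?R" by (rule card_mono[rotated])
      also have "\<dots> \<le> card A + card ({half p} \<times> T \<union> T \<times> {half p})"
        by (rule order.trans[OF card_Un_le]) (simp add: card_image)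
      also have "\<dots> \<le> card A + (card T + card T)"
        using card_Un_le[of "{half p} \<times> T" "T \<times> {half p}"] by (simp add: card_cartesian_product)
      finally show ?thesis using cA cT r by simp
    qed
    show "card {p \<in> P. J p b} \<le> r" if b: "b \<in> B" for b
    proof (cases b)
      case (Inl l)
      have "inj_on fst {p \<in> P. J p b}" by (rule inj_onI) (auto simp: Inl J_def)
      moreover have "fst ` {p \<in> P. J p b} \<subseteq> {..<n}" by (auto simp: P_def)
      ultimately show ?thesis using card_inj_on_le[of fst "{p \<in> P. J p b}" "{..<n}"] r by simp
    next
      case (Inr kk)
      have half_card: "card {p \<in> P. half p = k} \<le> (n + 1) div 2" for k
      proof -
        have "{p \<in> P. half p = k} \<subseteq> {fst k} \<times> {y. y < n \<and> y mod 2 = snd k}"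
          by (auto simp: P_def half_def)
        then have "card {p \<in> P. half p = k} \<le> card ({fst k} \<times> {y. y < n \<and> y mod 2 = snd k})"
          by (intro card_mono) auto
        also have "\<dots> \<le> (n + 1) div 2"
          using card_parity_class_le by (simp add: card_cartesian_product)
        finally show ?thesis .
      qed
      have "{p \<in> P. J p b} = {p \<in> P. half p = fst kk} \<union> {p \<in> P. half p = snd kk}"
        by (auto simp: Inr J_def)
      then have "card {p \<in> P. J p b} \<le> (n + 1) div 2 + (n + 1) div 2"
        using half_card[of "fst kk"] half_card[of "snd kk"] card_Un_le[of "{p \<in> P. half p = fst kk}" "{p \<in> P. half p = snd kk}"]
        by simp
      then show ?thesis using r D1 by simp
    qed
    show "\<exists>b\<in>B. J p b \<and> J p' b" if p: "p \<in> P" "p' \<in> P" "p \<noteq> p'" for p p'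
    proof (cases "bad (fst p) (fst p')")
      case True
      then have "Inr (half p, half p') \<in> B" using p by (auto simp: B_def pairs_def half_def P_def)
      moreover have "J p (Inr (half p, half p'))" "J p' (Inr (half p, half p'))" by (auto simp: J_def)
      ultimately show ?thesis by blast
    next
      case False
      moreover have "snd p < n" "snd p' < n" "n > 0" using p n by (auto simp: P_def)
      ultimately obtain m c where "m < n" "c < n" "snd p = (m * fst p + c) mod n" "snd p' = (m * fst p' + c) mod n"
        using line_mod_through_two_points[of n "fst p" "fst p'" "snd p" "snd p'"] unfolding bad_def by blast
      then have "Inl (m, c) \<in> B \<and> J p (Inl (m, c)) \<and> J p' (Inl (m, c))"
        by (auto simp: B_def P_def J_def)
      then show ?thesis by blast
    qed
  qed
qed

section \<open>Density of the numbers p^i q^j\<close>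

lemma prime_powers_incommensurable:
  fixes p q :: nat
  assumes "prime p" "prime q" "p \<noteq> q" "k > 0"
  shows "p ^ k \<noteq> q ^ l"
proof
  assume eq: "p ^ k = q ^ l"
  have "p dvd p ^ k" using assms(4) by simp
  then have "p dvd q ^ l" by (simp only: eq)
  then have "p dvd q" using assms(1) prime_dvd_power by blast
  then show False using primes_dvd_imp_eq assms(1-3) by blast
qed

text \<open>Dirichlet approximation of ln p / ln q, multiplied by ln q; unique factorisation makes
  the two powers distinct.\<close>

lemma prime_power_ratio_near_1:
  fixes p q :: nat and \<delta> :: real
  assumes p: "prime p" and q: "prime q" and pq: "p \<noteq> q" and \<delta>: "\<delta> > 0"
  obtains k l where "real (p ^ k) \<noteq> real (q ^ l)" "\<bar>real k * ln p - real l * ln q\<bar> < \<delta>"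
proof -
  have p2: "p \<ge> 2" and q2: "q \<ge> 2" using p q prime_ge_2_nat by auto
  have lp: "ln (real p) > 0" and lq: "ln (real q) > 0" using p2 q2 by auto
  \<comment> \<open>The last condition forces the approximating numerator h to be positive, so that
    it can serve as an exponent.\<close>
  obtain N :: nat where N: "N > 0" "ln q / N < \<delta>" "1 / N < ln p / ln q"
  proof -
    have "eventually (\<lambda>N::nat. ln q / N < \<delta>) at_top" "eventually (\<lambda>N::nat. 1 / N < ln p / ln q) at_top"
      by (rule order_tendstoD(2)[of _ 0]; use \<delta> lp lq in \<open>(real_asymp | simp)\<close>)+
    then have "eventually (\<lambda>N::nat. N > 0 \<and> ln q / N < \<delta> \<and> 1 / N < ln p / ln q) at_top"
      using eventually_gt_at_top[of 0] by eventually_elim auto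
    then show ?thesis using that by (auto simp: eventually_at_top_linorder)
  qed
  obtain h k where hk: "0 < k" "\<bar>of_int k * (ln p / ln q) - of_int h\<bar> < 1 / real N"
    using Dirichlet_approx[OF N(1)] by metis
  have "ln p / ln q \<le> of_int k * (ln p / ln q)"
    using mult_right_mono[of 1 "of_int k" "ln (real p) / ln (real q)"] hk(1) lp lq by simp
  then have "of_int h > (0::real)" using hk(2) N(3) by linarith
  then have h: "h > 0" by simp
  have "\<bar>of_int k * ln p - of_int h * ln q\<bar> = \<bar>of_int k * (ln p / ln q) - of_int h\<bar> * ln q"
    using lq by (simp add: abs_mult_pos field_simps abs_mult_pos' flip: abs_mult_pos)
  also have "\<dots> < 1 / real N * ln q" using hk(2) lq by (intro mult_strict_right_mono)
  also have "\<dots> < \<delta>" using N by simp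
  finally have "\<bar>real (nat k) * ln p - real (nat h) * ln q\<bar> < \<delta>" using hk h by simp
  moreover have "p ^ nat k \<noteq> q ^ nat h" using prime_powers_incommensurable[OF p q pq] hk(1) by simp
  ultimately show ?thesis using that by (metis of_nat_eq_iff)
qed

text \<open>If \<open>A/B\<close> is slightly above 1, where \<open>A = p\<^sup>k\<close> and \<open>B = q\<^sup>l\<close>, then trading factors \<open>B\<close> for factors \<open>A\<close>
  moves in small steps from \<open>B\<^sup>M q\<^sup>s\<close> past \<open>B\<^sup>M q\<^sup>s\<^sup>+\<^sup>1\<close>.\<close>

lemma products_of_powers_dense_aux:
  fixes A B q :: nat and c :: real
  assumes AB: "B < A" "B > 0" and c: "real A \<le> c * real B" and q: "q \<ge> 2"
  shows "\<exists>R. \<forall>x\<ge>R. \<exists>i j s. A ^ i * B ^ j * q ^ s \<le> x \<and> real x \<le> c * real (A ^ i * B ^ j * q ^ s)"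
proof -
  have "real A / real B > 1" using AB by simp
  \<comment> \<open>M trades multiply by more than q, so the steps starting at
    \<open>B ^ M * q ^ s\<close> bridge the whole interval up to
    \<open>B ^ M * q ^ Suc s\<close>.\<close>
  then obtain M where "real q < (real A / real B) ^ M" using real_arch_pow by blast
  then have M: "real q * real B ^ M < real A ^ M"
    using AB by (simp add: power_divide pos_less_divide_eq)
  then have M': "q * B ^ M < A ^ M" by (metis of_nat_less_iff of_nat_mult of_nat_power)
  have "\<exists>i j s. A ^ i * B ^ j * q ^ s \<le> x \<and> real x \<le> c * real (A ^ i * B ^ j * q ^ s)" if x: "x \<ge> B ^ M" for x
  proof -
    define S where "S = {s. B ^ M * q ^ s \<le> x}"
    have "s \<le> x" if "s \<in> S" for s
    proof -
      have "s < q ^ s" using q by (intro power_gt_expt) simp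
      also have "\<dots> \<le> B ^ M * q ^ s" using AB by simp
      finally show ?thesis using that by (simp add: S_def)
    qed
    then have finS: "finite S" using finite_nat_set_iff_bounded_le by blast
    have S0: "0 \<in> S" using x by (simp add: S_def)
    define s where "s = Max S"
    have "s \<in> S" unfolding s_def using S0 by (intro Max_in finS) auto
    then have s: "B ^ M * q ^ s \<le> x" by (simp add: S_def)
    have "Suc s \<notin> S" using Max_ge[OF finS, of "Suc s"] by (auto simp: s_def)
    then have s': "x < B ^ M * q ^ Suc s" by (simp add: S_def)
    \<comment> \<open>At the last trade that stays below x, the next one exceeds x while growing
      only by the factor A/B \<le> c.\<close>
    define T where "T = {i. i \<le> M \<and> A ^ i * B ^ (M - i) * q ^ s \<le> x}"
    have finT: "finite T" by (rule finite_subset[of _ "{..M}"]) (auto simp: T_def)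
    have T0: "0 \<in> T" using s by (simp add: T_def)
    define i where "i = Max T"
    have "i \<in> T" unfolding i_def using T0 by (intro Max_in finT) auto
    then have i: "i \<le> M" "A ^ i * B ^ (M - i) * q ^ s \<le> x" by (auto simp: T_def)
    have "M \<notin> T"
    proof
      assume "M \<in> T"
      then have "A ^ M * q ^ s \<le> x" by (simp add: T_def)
      moreover have "(q * B ^ M) * q ^ s \<le> A ^ M * q ^ s" using M' by (intro mult_right_mono) auto
      moreover have "B ^ M * q ^ Suc s = (q * B ^ M) * q ^ s" by simp
      ultimately show False using s' by linarith
    qed
    then have "i < M" using \<open>i \<in> T\<close> i(1) by (cases "i = M") auto
    have "Suc i \<notin> T" using Max_ge[OF finT, of "Suc i"] by (auto simp: i_def)
    then have "x < A ^ Suc i * B ^ (M - Suc i) * q ^ s" using \<open>i < M\<close> by (simp add: T_def)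
    then have "real x \<le> real (A ^ Suc i * B ^ (M - Suc i) * q ^ s)" by linarith
    also have "\<dots> = real A * real (A ^ i * B ^ (M - Suc i) * q ^ s)" by simp
    also have "\<dots> \<le> c * real B * real (A ^ i * B ^ (M - Suc i) * q ^ s)"
      using c by (intro mult_right_mono) auto
    also have "\<dots> = c * real (A ^ i * B ^ Suc (M - Suc i) * q ^ s)" by simp
    also have "Suc (M - Suc i) = M - i" using \<open>i < M\<close> by simp
    finally show ?thesis using i by blast
  qed
  then show ?thesis by blast
qed

text \<open>Whichever of \<open>p ^ k\<close> and \<open>q ^ l\<close> is larger plays A, the other
  B; the additional \<open>q ^ s\<close> merges into the power of q.\<close>

lemma prime_power_products_dense:
  fixes p q :: nat and c :: real
  assumes p: "prime p" and q: "prime q" and pq: "p \<noteq> q" and c: "c > 1"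
  shows "\<forall>\<^sub>F x in at_top. \<exists>i j. p ^ i * q ^ j \<le> x \<and> real x \<le> c * real (p ^ i * q ^ j)"
proof -
  have p2: "p \<ge> 2" and q2: "q \<ge> 2" using p q prime_ge_2_nat by auto
  obtain k l where kl: "real (p ^ k) \<noteq> real (q ^ l)" "\<bar>real k * ln p - real l * ln q\<bar> < ln c"
    using prime_power_ratio_near_1[OF p q pq, of "ln c"] c by auto
  have ln_p: "ln (real (p ^ k)) = real k * ln p" and ln_q: "ln (real (q ^ l)) = real l * ln q"
    using p2 q2 by (simp_all add: ln_realpow)
  have pos: "real (p ^ k) > 0" "real (q ^ l) > 0" using p2 q2 by auto
  have "real (p ^ k) < c * real (q ^ l)"
  proof -
    have "ln (real (p ^ k)) < ln (c * real (q ^ l))"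
      using kl(2) pos c by (simp only: ln_mult_pos ln_p ln_q)
    then show ?thesis using pos c by (subst (asm) ln_less_cancel_iff) auto
  qed
  moreover have "real (q ^ l) < c * real (p ^ k)"
  proof -
    have "ln (real (q ^ l)) < ln (c * real (p ^ k))"
      using kl(2) pos c by (simp only: ln_mult_pos ln_p ln_q)
    then show ?thesis using pos c by (subst (asm) ln_less_cancel_iff) auto
  qed
  moreover have "p ^ k < q ^ l \<or> q ^ l < p ^ k" using kl(1) by (metis linorder_neqE_nat)
  ultimately have "\<exists>R. \<forall>x\<ge>R. \<exists>i j. p ^ i * q ^ j \<le> x \<and> real x \<le> c * real (p ^ i * q ^ j)"
  proof (elim disjE, goal_cases)
    case 1
    obtain R where R: "\<forall>x\<ge>R. \<exists>i j s. (q ^ l) ^ i * (p ^ k) ^ j * q ^ s \<le> x \<and>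
        real x \<le> c * real ((q ^ l) ^ i * (p ^ k) ^ j * q ^ s)"
      using products_of_powers_dense_aux[of "p ^ k" "q ^ l" c q] 1 pos q2 by auto
    have "(q ^ l) ^ i * (p ^ k) ^ j * q ^ s = p ^ (k * j) * q ^ (l * i + s)" for i j s
      by (simp add: power_mult power_add)
    then show ?case using R by metis
  next
    case 2
    obtain R where R: "\<forall>x\<ge>R. \<exists>i j s. (p ^ k) ^ i * (q ^ l) ^ j * q ^ s \<le> x \<and>
        real x \<le> c * real ((p ^ k) ^ i * (q ^ l) ^ j * q ^ s)"
      using products_of_powers_dense_aux[of "q ^ l" "p ^ k" c q] 2 pos q2 by auto
    have "(p ^ k) ^ i * (q ^ l) ^ j * q ^ s = p ^ (k * i) * q ^ (l * j + s)" for i j s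
      by (simp add: power_mult power_add)
    then show ?case using R by metis
  qed
  then show ?thesis by (simp add: eventually_at_top_linorder)
qed

section \<open>Non-units and the asymptotic bound\<close>

lemma card_cong_class_le:
  fixes n p x :: nat
  assumes "p > 0"
  shows "card {x'. x' < n \<and> int p dvd int x - int x'} \<le> n div p + 1"
proof -
  let ?A = "{x'. x' < n \<and> int p dvd int x - int x'}"
  have "inj_on (\<lambda>y. y div p) ?A"
  proof (rule inj_onI)
    fix y z assume "y \<in> ?A" "z \<in> ?A" and eq: "y div p = z div p"
    then have "int p dvd int x - int y" "int p dvd int x - int z" by auto
    then have "int p dvd (int x - int z) - (int x - int y)" by (rule dvd_diff[rotated])
    then have "int p dvd int y - int z" by simp
    then have "int y mod int p = int z mod int p" by (simp only: mod_eq_dvd_iff)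
    then have "int (y mod p) = int (z mod p)" by (simp only: of_nat_mod)
    then have "y mod p = z mod p" by (simp only: of_nat_eq_iff)
    then have "y div p * p + y mod p = z div p * p + z mod p" using eq by simp
    then show "y = z" by (simp only: div_mult_mod_eq)
  qed
  moreover have "(\<lambda>y. y div p) ` ?A \<subseteq> {..n div p}"
    by (auto intro: div_le_mono)
  ultimately have "card ?A \<le> card {..n div p}" by (rule card_inj_on_le) simp
  then show ?thesis by simp
qed

text \<open>A non-unit is divisible by p or q. Relative to n the bound is about 1/p + 1/q whatever i
  and j are, so the exponents remain free to bring n close to r.\<close>

lemma card_nonunits_le:
  fixes p q i j x :: nat
  assumes p: "prime p" and q: "prime q"
  defines "n \<equiv> p ^ i * q ^ j"
  shows "card {x'. x' < n \<and> \<not> coprime (int x - int x') (int n)} \<le> n div p + n div q + 2"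
proof -
  have pr: "prime (int p)" "prime (int q)" using p q by auto
  have "int p dvd a \<or> int q dvd a" if "\<not> coprime a (int n)" for a
    using that pr unfolding n_def
    by (auto simp: coprime_commute[of a] intro: prime_imp_coprime)
  then have "{x'. x' < n \<and> \<not> coprime (int x - int x') (int n)} \<subseteq>
      {x'. x' < n \<and> int p dvd int x - int x'} \<union> {x'. x' < n \<and> int q dvd int x - int x'}" by blast
  then have "card {x'. x' < n \<and> \<not> coprime (int x - int x') (int n)} \<le>
      card ({x'. x' < n \<and> int p dvd int x - int x'} \<union> {x'. x' < n \<and> int q dvd int x - int x'})"
    by (rule card_mono[rotated]) auto
  also have "\<dots> \<le> (n div p + 1) + (n div q + 1)"
    using card_cong_class_le[of p n x] card_cong_class_le[of q n x] p q prime_gt_0_nat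
    by (intro order.trans[OF card_Un_le] add_mono) auto
  finally show ?thesis by simp
qed

text \<open>Of r, 4 \<epsilon> r is reserved for the 4D additional blocks and rounding; taking the
  floor costs at most \<epsilon> r and the density factor 1 + \<epsilon> another \<epsilon> r, so n
  \<ge> (1 - 6 \<epsilon>) r. Squaring, with slack, leaves 1 - 14 \<epsilon>, and w = n^2 - 1 loses
  at most 2 \<epsilon> r^2 more.\<close>

lemma near_optimal_hypergraph:
  fixes \<epsilon> :: real
  assumes \<epsilon>: "0 < \<epsilon>" "\<epsilon> < 1 / 16"
  shows "\<forall>\<^sub>F r in at_top. \<exists>w. (1 - 16 * \<epsilon>) * real r ^ 2 \<le> real w \<and>
    (\<exists>(V::nat set) E. uniform_hypergraph r V E \<and> nice V E \<and> \<not> strongly_weighted w E)"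
proof -
  \<comment> \<open>With 1/p and 1/q at most \<epsilon>/8, 4D \<le> \<epsilon> n + 8, hence at most
    2 \<epsilon> r for large r.\<close>
  obtain p where p: "prime p" "p > nat \<lceil>8 / \<epsilon>\<rceil>" using bigger_prime by blast
  obtain q where q: "prime q" "q > p" using bigger_prime by blast
  have "8 / \<epsilon> \<le> real p" "8 / \<epsilon> \<le> real q" using p(2) q(2) by linarith+
  then have inv: "1 / real p \<le> \<epsilon> / 8" "1 / real q \<le> \<epsilon> / 8"
    using \<epsilon> prime_gt_0_nat[OF p(1)] prime_gt_0_nat[OF q(1)] by (simp_all add: field_simps)
  have "\<forall>\<^sub>F x in at_top. \<exists>i j. p ^ i * q ^ j \<le> x \<and> real x \<le> (1 + \<epsilon>) * real (p ^ i * q ^ j)"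
    using prime_power_products_dense[OF p(1) q(1)] q(2) \<epsilon> by simp
  then obtain R where R: "\<And>x. x \<ge> R \<Longrightarrow> \<exists>i j. p ^ i * q ^ j \<le> x \<and> real x \<le> (1 + \<epsilon>) * real (p ^ i * q ^ j)"
    by (auto simp: eventually_at_top_linorder)
  have ev: "\<forall>\<^sub>F r::nat in at_top. (1 - 4 * \<epsilon>) * real r \<ge> real R + 1 \<and> \<epsilon> * real r \<ge> 8 \<and> (1 - 5 * \<epsilon>) * real r \<ge> 4 \<and> 2 * \<epsilon> * real r ^ 2 \<ge> 1"
    using \<epsilon> by (intro eventually_conj) real_asymp+
  then show ?thesis
  proof eventually_elim
    fix r :: nat
    assume *: "(1 - 4 * \<epsilon>) * real r \<ge> real R + 1 \<and> \<epsilon> * real r \<ge> 8 \<and> (1 - 5 * \<epsilon>) * real r \<ge> 4 \<and> 2 * \<epsilon> * real r ^ 2 \<ge> 1"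
    define x where "x = nat \<lfloor>(1 - 4 * \<epsilon>) * real r\<rfloor>"
    have xle: "real x \<le> (1 - 4 * \<epsilon>) * real r" and xge: "real x \<ge> (1 - 4 * \<epsilon>) * real r - 1"
      using * unfolding x_def by linarith+
    have xr: "real x \<ge> (1 - 5 * \<epsilon>) * real r" using xge * by (simp add: algebra_simps)
    have "x \<ge> R" using xge * by linarith
    then obtain i j where ij: "p ^ i * q ^ j \<le> x" "real x \<le> (1 + \<epsilon>) * real (p ^ i * q ^ j)" using R by blast
    define n where "n = p ^ i * q ^ j"
    define D where "D = n div p + n div q + 2"
    have nx: "real n \<le> real x" "real x \<le> (1 + \<epsilon>) * real n" using ij unfolding n_def by (simp_all only: of_nat_le_iff)
    have nr: "real n \<le> real r"
      using nx(1) xle \<epsilon> mult_right_mono[of "1 - 4 * \<epsilon>" 1 "real r"] by simp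
    have n2: "n \<ge> 2"
    proof -
      have "4 \<le> (1 + \<epsilon>) * real n" using * xr nx by linarith
      also have "\<dots> \<le> 2 * real n" using \<epsilon> by (intro mult_right_mono) auto
      finally show ?thesis by simp
    qed
    have lower: "(1 - 6 * \<epsilon>) * real r \<le> real n"
    proof -
      have "(1 - 6 * \<epsilon>) * (1 + \<epsilon>) \<le> 1 - 5 * \<epsilon>" using \<epsilon> by (simp add: algebra_simps)
      then have "(1 - 6 * \<epsilon>) * (1 + \<epsilon>) * real r \<le> (1 - 5 * \<epsilon>) * real r" by (rule mult_right_mono) simp
      also have "\<dots> \<le> (1 + \<epsilon>) * real n" using xr nx by linarith
      finally have "(1 + \<epsilon>) * ((1 - 6 * \<epsilon>) * real r) \<le> (1 + \<epsilon>) * real n" by (simp add: algebra_simps)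
      then show ?thesis using \<epsilon> by (subst (asm) mult_le_cancel_left_pos) auto
    qed
    have "real (n div p) \<le> real n * (1 / real p)" "real (n div q) \<le> real n * (1 / real q)"
      using of_nat_div_le_of_nat[of n p, where ?'a = real] of_nat_div_le_of_nat[of n q, where ?'a = real] by simp_all
    moreover have "real n * (1 / real p) \<le> real n * (\<epsilon> / 8)" "real n * (1 / real q) \<le> real n * (\<epsilon> / 8)"
      using inv by (auto intro!: mult_left_mono simp del: times_divide_eq_right)
    ultimately have "real (n div p) + real (n div q) \<le> real n * (\<epsilon> / 8) + real n * (\<epsilon> / 8)" by linarith
    moreover have "real (4 * D) = 4 * (real (n div p) + real (n div q)) + 8" unfolding D_def by simp
    ultimately have "real (4 * D) \<le> \<epsilon> * real n + 8" by simp
    also have "\<dots> \<le> \<epsilon> * real r + \<epsilon> * real r" using * nr \<epsilon> by (intro add_mono mult_left_mono) auto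
    finally have "real (n + 4 * D) \<le> real r" using nx xle * by (simp add: algebra_simps)
    then have nD: "n + 4 * D \<le> r" by linarith
    have n2': "n^2 \<ge> 1" using n2 by simp
    then have "n^2 - 1 < n^2" by linarith
    then have "\<exists>(V::nat set) E. uniform_hypergraph r V E \<and> nice V E \<and> \<not> strongly_weighted (n^2 - 1) E"
      using affine_mod_hypergraph[OF n2 nD] card_nonunits_le[OF p(1) q(1), of i j] by (simp add: n_def D_def)
    moreover have "(1 - 16 * \<epsilon>) * real r ^ 2 \<le> real (n^2 - 1)"
    proof -
      have "((1 - 6 * \<epsilon>) * real r) ^ 2 \<le> real n ^ 2" using lower \<epsilon> by (intro power_mono) auto
      moreover have "(1 - 14 * \<epsilon>) * real r ^ 2 \<le> (1 - 6 * \<epsilon>) ^ 2 * real r ^ 2"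
        using \<epsilon> by (intro mult_right_mono) (auto simp: power2_eq_square algebra_simps)
      ultimately have "(1 - 14 * \<epsilon>) * real r ^ 2 \<le> real n ^ 2" by (simp add: power_mult_distrib)
      moreover have "real (n^2 - 1) = real n ^ 2 - 1" using n2' by (simp add: of_nat_diff)
      ultimately show ?thesis using * by (simp add: algebra_simps)
    qed
    ultimately show "\<exists>w. (1 - 16 * \<epsilon>) * real r ^ 2 \<le> real w \<and>
      (\<exists>(V::nat set) E. uniform_hypergraph r V E \<and> nice V E \<and> \<not> strongly_weighted w E)" by blast
  qed
qed

lemma asymptotically_optimal_hypergraphs:
  "\<exists>g::nat \<Rightarrow> nat. ((\<lambda>r. real (g r) / real r ^ 2) \<longlongrightarrow> 0) at_top \<and>
     (\<forall>\<^sub>F r in at_top. \<exists>(V::nat set) E. uniform_hypergraph r V E \<and> nice V E \<and>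
        \<not> strongly_weighted (r^2 - g r) E)"
proof -
  define good where "good w r \<longleftrightarrow>
    (\<exists>(V::nat set) E. uniform_hypergraph r V E \<and> nice V E \<and> \<not> strongly_weighted w E)" for w r
  \<comment> \<open>One function for all \<epsilon>: each \<epsilon> eventually supplies an
    admissible d \<le> \<epsilon> r^2, and the least d is no larger.\<close>
  define g where "g r = (LEAST d. good (r^2 - d) r)" for r
  have small: "\<forall>\<^sub>F r in at_top. good (r^2 - g r) r \<and> real (g r) \<le> \<epsilon> * real r ^ 2" if \<epsilon>: "0 < \<epsilon>" "\<epsilon> < 1" for \<epsilon>
    using near_optimal_hypergraph[of "\<epsilon> / 16"]
  proof (rule eventually_mono)
    fix r assume "\<exists>w. (1 - 16 * (\<epsilon> / 16)) * real r ^ 2 \<le> real w \<and>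
      (\<exists>(V::nat set) E. uniform_hypergraph r V E \<and> nice V E \<and> \<not> strongly_weighted w E)"
    then obtain w where w: "(1 - \<epsilon>) * real r ^ 2 \<le> real w" "good w r" by (auto simp: good_def)
    \<comment> \<open>Capping w at r^2 lets truncated subtraction return it from d. The cap is
      harmless because allowing fewer weights preserves failure.\<close>
    define d where "d = r^2 - min w (r^2)"
    have "good (min w (r^2)) r"
    proof -
      obtain V :: "nat set" and E where H: "uniform_hypergraph r V E" "nice V E" "\<not> strongly_weighted w E"
        using w by (auto simp: good_def)
      have "\<not> strongly_weighted (min w (r^2)) E"
        using H(3) unfolding strongly_weighted_def weighting_def by (meson min.bounded_iff)
      then show ?thesis using H by (auto simp: good_def)
    qed
    then have d: "good (r^2 - d) r" by (simp add: d_def)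
    then have "good (r^2 - g r) r" unfolding g_def by (rule LeastI)
    moreover have "g r \<le> d" unfolding g_def using d by (rule Least_le)
    then have "real (g r) \<le> real d" by simp
    moreover have "real d \<le> \<epsilon> * real r ^ 2"
    proof (cases "w \<le> r^2")
      case True
      then have "real d = real r ^ 2 - real w" by (simp add: d_def of_nat_diff)
      then show ?thesis using w(1) by (simp add: algebra_simps)
    next
      case False
      then show ?thesis using \<epsilon> by (simp add: d_def)
    qed
    ultimately show "good (r^2 - g r) r \<and> real (g r) \<le> \<epsilon> * real r ^ 2" by linarith
  qed (use \<epsilon> in auto)
  have "((\<lambda>r. real (g r) / real r ^ 2) \<longlongrightarrow> 0) at_top"
  proof (rule tendstoI)
    fix e :: real assume e: "e > 0"
    define \<epsilon> where "\<epsilon> = min (e / 2) (1 / 2)"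
    have "0 < \<epsilon>" "\<epsilon> < 1" "\<epsilon> < e" using e by (auto simp: \<epsilon>_def)
    show "\<forall>\<^sub>F r in at_top. dist (real (g r) / real r ^ 2) 0 < e"
      using small[OF \<open>0 < \<epsilon>\<close> \<open>\<epsilon> < 1\<close>] eventually_gt_at_top[of 0]
    proof eventually_elim
      case (elim r)
      then have "real (g r) / real r ^ 2 \<le> \<epsilon>" by (simp add: field_simps)
      then show ?case using \<open>\<epsilon> < e\<close> by simp
    qed
  qed
  moreover have "\<forall>\<^sub>F r in at_top. good (r^2 - g r) r"
    using small[of "1/2"] by (auto elim: eventually_mono)
  ultimately show ?thesis unfolding good_def by blast
qed

section \<open>Projective planes from systems of affine lines\<close>

text \<open>\<open>L m c x\<close> is to be read as the ordinate at x of the line with slope m and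
  intercept c. The projective completion has q^2 + q + 1 points, of degree at most q + 1.\<close>

lemma projective_plane_hypergraph:
  fixes L :: "nat \<Rightarrow> nat \<Rightarrow> nat \<Rightarrow> nat"
  assumes q: "q \<ge> 2" and w: "w < q^2 + q + 1"
    and range: "\<And>m c x. m < q \<Longrightarrow> c < q \<Longrightarrow> x < q \<Longrightarrow> L m c x < q"
    and inj: "\<And>m x. m < q \<Longrightarrow> x < q \<Longrightarrow> inj_on (\<lambda>c. L m c x) {..<q}"
    and two: "\<And>x x' y y'. x < q \<Longrightarrow> x' < q \<Longrightarrow> x \<noteq> x' \<Longrightarrow> y < q \<Longrightarrow> y' < q \<Longrightarrow>
      \<exists>m<q. \<exists>c<q. L m c x = y \<and> L m c x' = y'"
  shows "\<exists>(V::nat set) E. uniform_hypergraph (q + 1) V E \<and> nice V E \<and> \<not> strongly_weighted w E"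
proof -
  text \<open>A first coordinate \<open>q\<close> marks the points at infinity \<open>(q, m)\<close>, where \<open>m\<close> is a slope (\<open>q\<close> for the
    vertical one), and the lines \<open>(q, x)\<close>, vertical for \<open>x < q\<close> and at infinity for \<open>x = q\<close>.\<close>
  define P where "P = {..<q} \<times> {..<q} \<union> {q} \<times> {..q}"
  \<comment> \<open>In the last case both are marked by q: the line is the one at infinity, or it is
    vertical and p must be the vertical point at infinity.\<close>
  define J where "J p l = (if fst p < q then (if fst l < q then snd p = L (fst l) (snd l) (fst p) else snd l = fst p)
    else if fst l < q then snd p = fst l else snd p = q \<or> snd l = q)" for p l :: "nat \<times> nat"
  have Pq: "fst p \<le> q" "snd p \<le> q" if "p \<in> P" for p using that by (auto simp: P_def)
  have card_le: "card S \<le> q + 1" if "f ` S \<subseteq> {..q}" "inj_on f S" for f :: "nat \<times> nat \<Rightarrow> nat" and S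
    using card_inj_on_le[OF that(2,1)] by simp
  show ?thesis
  proof (rule pairwise_incident_hypergraph[where P = P and B = P and J = J])
    show "finite P" "finite P" by (simp_all add: P_def)
    show "2 \<le> q + 1" using q by simp
    have "card P = q * q + (q + 1)"
      unfolding P_def by (subst card_Un_disjoint) (auto simp: card_cartesian_product)
    then show "w < card P" using w by (simp add: power2_eq_square)
    show "card {l \<in> P. J p l} \<le> q + 1" if p: "p \<in> P" for p
    proof (cases "fst p < q")
      case True
      have "inj_on fst {l \<in> P. J p l}"
      proof (rule inj_onI)
        fix l l' assume l: "l \<in> {l \<in> P. J p l}" "l' \<in> {l \<in> P. J p l}" "fst l = fst l'"
        have "snd l = snd l'"
        proof (cases "fst l < q")
          case m: True
          then have "L (fst l) (snd l) (fst p) = L (fst l) (snd l') (fst p)" "snd l < q" "snd l' < q"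
            using l True by (auto simp: J_def P_def)
          then show ?thesis using inj[OF m True] by (auto dest: inj_onD)
        next
          case False
          then show ?thesis using l True by (auto simp: J_def)
        qed
        then show "l = l'" using l(3) by (simp add: prod_eq_iff)
      qed
      then show ?thesis using Pq by (intro card_le[of fst]) auto
    next
      case False
      \<comment> \<open>For m < q the lines through (q, m) are the parallels (m, c) and (q, q); for
        m = q they are all (q, x). Either way second coordinates differ.\<close>
      have "inj_on snd {l \<in> P. J p l}"
        using False p by (intro inj_onI) (auto simp: J_def P_def split: if_splits)
      then show ?thesis using Pq by (intro card_le[of snd]) auto
    qed
    show "card {p \<in> P. J p l} \<le> q + 1" if l: "l \<in> P" for l
    proof (cases "fst l < q")
      case True
      have "inj_on fst {p \<in> P. J p l}"
        using True l by (intro inj_onI) (auto simp: J_def P_def split: if_splits)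
      then show ?thesis using Pq by (intro card_le[of fst]) auto
    next
      case False
      have "inj_on snd {p \<in> P. J p l}"
        using False l by (intro inj_onI) (auto simp: J_def P_def split: if_splits)
      then show ?thesis using Pq by (intro card_le[of snd]) auto
    qed
    have aff_inf: "\<exists>l\<in>P. J (x, y) l \<and> J (q, m) l" if xy: "x < q" "y < q" and m: "m \<le> q" for x y m
    proof (cases "m = q")
      case True
      then show ?thesis using xy by (intro bexI[of _ "(q, x)"]) (auto simp: J_def P_def)
    next
      case False
      then have mq: "m < q" using m by simp
      \<comment> \<open>An injective self-map of a finite set is onto: some line of slope m passes
        through (x, y).\<close>
      have "(\<lambda>c. L m c x) ` {..<q} = {..<q}"
        using range[OF mq] inj[OF mq] xy by (intro endo_inj_surj) auto
      then obtain c where "c < q" "L m c x = y" using xy by (metis imageE lessThan_iff)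
      then show ?thesis using xy mq by (intro bexI[of _ "(m, c)"]) (auto simp: J_def P_def)
    qed
    show "\<exists>l\<in>P. J p l \<and> J p' l" if p: "p \<in> P" "p' \<in> P" "p \<noteq> p'" for p p'
    proof -
      obtain x y x' y' where xy: "p = (x, y)" "p' = (x', y')" by (cases p; cases p') blast
      consider "x < q" "x' < q" "x = x'" | "x < q" "x' < q" "x \<noteq> x'" | "x < q" "x' = q" | "x = q" "x' < q" | "x = q" "x' = q"
        using p xy by (auto simp: P_def)
      then show ?thesis
      proof cases
        case 1
        then show ?thesis using xy by (intro bexI[of _ "(q, x)"]) (auto simp: J_def P_def)
      next
        case 2
        moreover have "y < q" "y' < q" using p xy 2 by (auto simp: P_def)
        ultimately obtain m c where "m < q" "c < q" "L m c x = y" "L m c x' = y'" using two by blast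
        then show ?thesis using xy 2 by (intro bexI[of _ "(m, c)"]) (auto simp: J_def P_def)
      next
        case 3
        then show ?thesis using p xy aff_inf[of x y y'] by (auto simp: P_def)
      next
        case 4
        then show ?thesis using p xy aff_inf[of x' y' y] by (auto simp: P_def)
      next
        case 5
        then show ?thesis using xy by (intro bexI[of _ "(q, q)"]) (auto simp: J_def P_def)
      qed
    qed
  qed
qed

section \<open>Prime ideals and their residue fields\<close>

text \<open>The residue field depends on the q of the proof and cannot be a type fixed beforehand;
  computation in it is done with the congruence \<open>eqm\<close> on representatives.\<close>

locale comm_ring_ideal =
  fixes M :: "'a::comm_ring_1 set"
  assumes zero_mem: "0 \<in> M" and add_mem: "x \<in> M \<Longrightarrow> y \<in> M \<Longrightarrow> x + y \<in> M"
    and mult_mem: "y \<in> M \<Longrightarrow> x * y \<in> M"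
begin

lemma uminus_mem: "x \<in> M \<Longrightarrow> - x \<in> M"
  using mult_mem[of x "-1"] by simp

lemma diff_mem: "x \<in> M \<Longrightarrow> y \<in> M \<Longrightarrow> x - y \<in> M"
  using add_mem[of x "- y"] uminus_mem[of y] by simp

definition eqm :: "'a \<Rightarrow> 'a \<Rightarrow> bool" where "eqm x y \<longleftrightarrow> x - y \<in> M"

lemma eqm_refl: "eqm x x" by (simp add: eqm_def zero_mem)

lemma eqm_sym: "eqm x y \<Longrightarrow> eqm y x"
  using uminus_mem[of "x - y"] by (simp add: eqm_def)

lemma eqm_trans: "eqm x y \<Longrightarrow> eqm y z \<Longrightarrow> eqm x z"
  using add_mem[of "x - y" "y - z"] by (simp add: eqm_def)

lemma eqm_add: "eqm x y \<Longrightarrow> eqm u v \<Longrightarrow> eqm (x + u) (y + v)"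
  using add_mem[of "x - y" "u - v"] by (simp add: eqm_def algebra_simps)

lemma eqm_mult: "eqm x y \<Longrightarrow> eqm u v \<Longrightarrow> eqm (x * u) (y * v)"
  using add_mem[OF mult_mem[of "x - y" u] mult_mem[of "u - v" y]] by (simp add: eqm_def algebra_simps)

lemma eqm_uminus: "eqm x y \<Longrightarrow> eqm (- x) (- y)"
  using uminus_mem[of "x - y"] by (simp add: eqm_def)

lemma eqm_power: "eqm x y \<Longrightarrow> eqm (x ^ n) (y ^ n)"
  by (induction n) (auto intro: eqm_mult eqm_refl)

text \<open>The middle binomial coefficients are multiples of p, hence their terms lie in M.\<close>

lemma eqm_frobenius_prime:
  assumes p: "prime p" "of_nat p \<in> M"
  shows "eqm ((x + y) ^ p) (x ^ p + y ^ p)"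
proof -
  have pos: "p > 0" using p prime_gt_0_nat by blast
  let ?t = "\<lambda>k. of_nat (p choose k) * x ^ k * y ^ (p - k)"
  have "(x + y) ^ p = (\<Sum>k\<le>p. ?t k)" by (rule binomial_ring)
  also have "{..p} = insert 0 (insert p {0<..<p})" using pos by auto
  also have "(\<Sum>k\<in>\<dots>. ?t k) = y ^ p + (x ^ p + (\<Sum>k\<in>{0<..<p}. ?t k))"
    using pos by simp
  finally have eq: "(x + y) ^ p - (x ^ p + y ^ p) = (\<Sum>k\<in>{0<..<p}. ?t k)" by (simp add: algebra_simps)
  have term_mem: "?t k \<in> M" if "0 < k" "k < p" for k
  proof -
    have "p dvd p choose k" using that p by (intro dvd_choose_prime) auto
    then obtain d where "p choose k = p * d" by blast
    then have "?t k = (of_nat d * x ^ k * y ^ (p - k)) * of_nat p" by (simp add: algebra_simps)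
    then show ?thesis using mult_mem[OF p(2)] by simp
  qed
  have "(\<Sum>k\<in>S. ?t k) \<in> M" if "finite S" "S \<subseteq> {0<..<p}" for S
    using that by (induction S rule: finite_induct) (auto intro: zero_mem add_mem term_mem)
  then show ?thesis unfolding eqm_def eq by blast
qed

lemma eqm_frobenius:
  assumes p: "prime p" "of_nat p \<in> M"
  shows "eqm ((x + y) ^ (p ^ k)) (x ^ (p ^ k) + y ^ (p ^ k))"
proof (induction k)
  case (Suc k)
  have "eqm (((x + y) ^ (p ^ k)) ^ p) ((x ^ (p ^ k) + y ^ (p ^ k)) ^ p)"
    by (rule eqm_power[OF Suc.IH])
  moreover have "eqm ((x ^ (p ^ k) + y ^ (p ^ k)) ^ p) ((x ^ (p ^ k)) ^ p + (y ^ (p ^ k)) ^ p)"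
    by (rule eqm_frobenius_prime[OF p])
  ultimately have "eqm (((x + y) ^ (p ^ k)) ^ p) ((x ^ (p ^ k)) ^ p + (y ^ (p ^ k)) ^ p)"
    by (rule eqm_trans)
  then show ?case by (simp add: power_mult[symmetric] mult.commute)
qed (simp add: eqm_refl)

end

text \<open>Zorn's lemma gives an ideal maximal among the proper ones containing I, and maximal
  ideals are prime.\<close>

lemma prime_ideal_exists:
  fixes I :: "'a::comm_ring_1 set"
  assumes I: "comm_ring_ideal I" and one: "1 \<notin> I"
  obtains M where "comm_ring_ideal M" "I \<subseteq> M" "1 \<notin> M" "\<And>a b. a * b \<in> M \<Longrightarrow> a \<in> M \<or> b \<in> M"
proof -
  define \<I> where "\<I> = {J. comm_ring_ideal J \<and> I \<subseteq> J \<and> 1 \<notin> J}"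
  have "\<exists>M\<in>\<I>. \<forall>J\<in>\<I>. M \<subseteq> J \<longrightarrow> J = M"
  proof (rule subset_Zorn_nonempty)
    show "\<I> \<noteq> {}" using I one by (auto simp: \<I>_def)
    fix C assume C: "C \<noteq> {}" "subset.chain \<I> C"
    have mem: "comm_ring_ideal J" "I \<subseteq> J" "1 \<notin> J" if "J \<in> C" for J
      using that C(2) by (auto simp: \<I>_def subset.chain_def)
    have "comm_ring_ideal (\<Union>C)"
    proof
      show "0 \<in> \<Union>C" using C(1) mem(1) comm_ring_ideal.zero_mem by blast
      fix x y assume y: "y \<in> \<Union>C"
      show "x * y \<in> \<Union>C" using y mem(1) comm_ring_ideal.mult_mem by blast
      assume x: "x \<in> \<Union>C"
      then obtain J K where JK: "x \<in> J" "J \<in> C" "y \<in> K" "K \<in> C" using y by blast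
      then have "J \<subseteq> K \<or> K \<subseteq> J" using C(2) by (auto simp: subset.chain_def)
      then show "x + y \<in> \<Union>C" using JK mem(1) comm_ring_ideal.add_mem by (metis UnionI subsetD)
    qed
    moreover have "I \<subseteq> \<Union>C" using C(1) mem(2) by blast
    moreover have "1 \<notin> \<Union>C" using mem(3) by blast
    ultimately show "\<Union>C \<in> \<I>" by (simp add: \<I>_def)
  qed
  then obtain M where M: "M \<in> \<I>" and max: "\<And>J. J \<in> \<I> \<Longrightarrow> M \<subseteq> J \<Longrightarrow> J = M" by blast
  interpret M: comm_ring_ideal M using M by (simp add: \<I>_def)
  have comax: "\<exists>u. 1 - u * a \<in> M" if "a \<notin> M" for a
  proof -
    \<comment> \<open>This is the ideal M + (a). It properly contains M, so by maximality it
      contains 1.\<close>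
    define J where "J = {x. \<exists>u. x - u * a \<in> M}"
    have "comm_ring_ideal J"
    proof
      show "0 \<in> J" unfolding J_def by (auto intro: exI[of _ 0] simp: M.zero_mem)
      fix x y assume "y \<in> J"
      then obtain v where v: "y - v * a \<in> M" by (auto simp: J_def)
      then have "x * (y - v * a) \<in> M" by (rule M.mult_mem)
      then show "x * y \<in> J" unfolding J_def by (auto intro!: exI[of _ "x * v"] simp: algebra_simps)
      assume "x \<in> J"
      then obtain u where "x - u * a \<in> M" by (auto simp: J_def)
      from M.add_mem[OF this v] show "x + y \<in> J"
        unfolding J_def by (auto intro!: exI[of _ "u + v"] simp: algebra_simps)
    qed
    moreover have "M \<subseteq> J" unfolding J_def by (auto intro: exI[of _ 0])
    moreover have "a \<in> J" unfolding J_def by (auto intro: exI[of _ 1] simp: M.zero_mem)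
    ultimately have "1 \<in> J" using max[of J] that M by (auto simp: \<I>_def)
    then show ?thesis by (simp add: J_def)
  qed
  have "a \<in> M \<or> b \<in> M" if ab: "a * b \<in> M" for a b
  proof (rule ccontr)
    assume "\<not> ?thesis"
    then obtain u where "1 - u * a \<in> M" and b: "b \<notin> M" using comax by blast
    then have "b * (1 - u * a) + u * (a * b) \<in> M" using ab by (intro M.add_mem M.mult_mem[of "1 - u * a" b] M.mult_mem[of "a * b" u])
    moreover have "b * (1 - u * a) + u * (a * b) = b" by (simp add: algebra_simps)
    ultimately show False using b by (simp only: not_True_eq_False)
  qed
  then show ?thesis using that M by (auto simp: \<I>_def)
qed

text \<open>\<open>T\<close> enumerates representatives of the residue field of \<open>M\<close>; \<open>L\<close> is the line \<open>y = m x + c\<close> over it.\<close>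

lemma lines_of_residue_field:
  fixes T :: "nat \<Rightarrow> 'a::comm_ring_1"
  assumes M: "comm_ring_ideal M" and prime: "\<And>a b. a * b \<in> M \<Longrightarrow> a \<in> M \<or> b \<in> M" and q: "q \<ge> 2"
    and frob: "\<And>g. g ^ q - g \<in> M" and ex: "\<And>g. \<exists>i<q. g - T i \<in> M"
    and uniq: "\<And>i j. i < q \<Longrightarrow> j < q \<Longrightarrow> T i - T j \<in> M \<Longrightarrow> i = j"
  obtains L :: "nat \<Rightarrow> nat \<Rightarrow> nat \<Rightarrow> nat" where "\<And>m c x. L m c x < q"
    "\<And>m x. inj_on (\<lambda>c. L m c x) {..<q}"
    "\<And>x x' y y'. x < q \<Longrightarrow> x' < q \<Longrightarrow> x \<noteq> x' \<Longrightarrow> y < q \<Longrightarrow> y' < q \<Longrightarrow>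
      \<exists>m<q. \<exists>c<q. L m c x = y \<and> L m c x' = y'"
proof -
  interpret M: comm_ring_ideal M by (rule M)
  define rep where "rep g = (SOME i. i < q \<and> M.eqm g (T i))" for g
  have rep: "rep g < q" "M.eqm g (T (rep g))" for g
    using someI_ex[of "\<lambda>i. i < q \<and> M.eqm g (T i)"] ex[of g] by (auto simp: rep_def M.eqm_def)
  have T_eq: "i = j" if "i < q" "j < q" "M.eqm (T i) (T j)" for i j
    using uniq that by (simp add: M.eqm_def)
  have rep_eq: "rep g = i" if "i < q" "M.eqm g (T i)" for g i
    using T_eq rep that M.eqm_sym M.eqm_trans by blast
  define L where "L m c x = rep (T m * T x + T c)" for m c x
  show thesis
  proof (rule that[of L])
    show "L m c x < q" for m c x by (simp add: L_def rep)
    show "inj_on (\<lambda>c. L m c x) {..<q}" for m x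
    proof (rule inj_onI)
      fix c c' assume c: "c \<in> {..<q}" "c' \<in> {..<q}" "L m c x = L m c' x"
      have "M.eqm (T m * T x + T c) (T m * T x + T c')"
        using rep(2)[of "T m * T x + T c"] rep(2)[of "T m * T x + T c'"] c(3)
        unfolding L_def by (metis M.eqm_sym M.eqm_trans)
      then have "M.eqm (T c) (T c')" by (simp add: M.eqm_def)
      then show "c = c'" using T_eq c by simp
    qed
    fix x x' y y' assume x: "x < q" "x' < q" "x \<noteq> x'" and y: "y < q" "y' < q"
    define u where "u = T x - T x'"
    have "u \<notin> M" using uniq x by (auto simp: u_def)
    \<comment> \<open>Since u^q - u lies in the prime ideal and u does not, u^(q - 2) inverts u
      modulo M. This supplies the division in the slope.\<close>
    have "q = Suc (Suc (q - 2))" using q by simp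
    then have "u ^ q = u * (u ^ (q - 2) * u)" by (metis power_Suc mult.commute)
    then have "u ^ q - u = u * (u ^ (q - 2) * u - 1)" by (simp add: algebra_simps)
    then have "u ^ (q - 2) * u - 1 \<in> M" using prime[of u] frob[of u] \<open>u \<notin> M\<close> by auto
    then have inv: "M.eqm (u ^ (q - 2) * u) 1" by (simp add: M.eqm_def)
    define m where "m = rep ((T y - T y') * u ^ (q - 2))"
    define c where "c = rep (T y - T m * T x)"
    have mq: "m < q" and cq: "c < q" by (simp_all add: m_def c_def rep)
    have Tm: "M.eqm (T m) ((T y - T y') * u ^ (q - 2))" and Tc: "M.eqm (T c) (T y - T m * T x)"
      unfolding m_def c_def by (intro M.eqm_sym[OF rep(2)])+
    have "M.eqm (T m * u) ((T y - T y') * u ^ (q - 2) * u)" by (intro M.eqm_mult Tm M.eqm_refl)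
    moreover have "M.eqm ((T y - T y') * (u ^ (q - 2) * u)) ((T y - T y') * 1)"
      by (intro M.eqm_mult inv M.eqm_refl)
    ultimately have Tmu: "M.eqm (T m * u) (T y - T y')" unfolding mult.assoc mult_1_right by (rule M.eqm_trans)
    have "M.eqm (T m * T x + T c) (T m * T x + (T y - T m * T x))" by (intro M.eqm_add Tc M.eqm_refl)
    then have "L m c x = y" unfolding L_def using y by (intro rep_eq) simp_all
    moreover have "L m c x' = y'"
    proof -
      have "M.eqm (T m * T x' + T c) (T m * T x' + (T y - T m * T x))" by (intro M.eqm_add Tc M.eqm_refl)
      moreover have "T m * T x' + (T y - T m * T x) = T y + - (T m * u)" by (simp add: u_def algebra_simps)
      moreover have "M.eqm (T y + - (T m * u)) (T y + - (T y - T y'))"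
        by (intro M.eqm_add M.eqm_uminus Tmu M.eqm_refl)
      ultimately have "M.eqm (T m * T x' + T c) (T y')" using M.eqm_trans by simp
      then show ?thesis unfolding L_def using y by (intro rep_eq)
    qed
    ultimately show "\<exists>m<q. \<exists>c<q. L m c x = y \<and> L m c x' = y'" using mq cq by blast
  qed
qed

section \<open>Integer polynomials at roots of unity\<close>

abbreviation ipoly_eval :: "int poly \<Rightarrow> complex \<Rightarrow> complex" where
  "ipoly_eval f \<equiv> poly (map_poly of_int f)"

lemma ipoly_eval_hom:
  "ipoly_eval (f + g) z = ipoly_eval f z + ipoly_eval g z"
  "ipoly_eval (f - g) z = ipoly_eval f z - ipoly_eval g z"
  "ipoly_eval (f * g) z = ipoly_eval f z * ipoly_eval g z"
  "ipoly_eval (f ^ k) z = ipoly_eval f z ^ k"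
  by (simp_all add: hom_distribs)

lemma ipoly_eval_prod: "ipoly_eval (\<Prod>i\<in>S. F i) z = (\<Prod>i\<in>S. ipoly_eval (F i) z)"
  by (induction S rule: infinite_finite_induct) (simp_all add: ipoly_eval_hom)

text \<open>Multiplication by \<open>f(z)\<close> is given, on the vector of powers of \<open>z\<close>, by an integer circulant matrix.\<close>

lemma algebraic_int_ipoly_eval_root_unity:
  fixes z :: complex
  assumes z: "z ^ n = 1" and n: "n > 0"
  shows "algebraic_int (ipoly_eval f z)"
proof -
  define \<alpha> where "\<alpha> = ipoly_eval f z"
  define N where "N = degree f"
  \<comment> \<open>Row i expresses f(z) z^i, with exponents reduced by z^n = 1. So \<alpha> is an
    eigenvalue and a root of the monic integral characteristic polynomial.\<close>
  define A :: "int mat" where "A = mat n n (\<lambda>(i, j). \<Sum>d\<le>N. if (i + d) mod n = j then coeff f d else 0)"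
  define v where "v = vec n (\<lambda>j. z ^ j)"
  have A: "A \<in> carrier_mat n n" by (simp add: A_def)
  let ?A = "map_mat of_int A :: complex mat"
  have cA: "?A \<in> carrier_mat n n" using A by simp
  have zmod: "z ^ (k mod n) = z ^ k" for k
  proof -
    have "z ^ k = z ^ (n * (k div n) + k mod n)" by simp
    also have "\<dots> = z ^ (k mod n)" unfolding power_add power_mult z by simp
    finally show ?thesis by simp
  qed
  have alpha: "\<alpha> = (\<Sum>d\<le>N. of_int (coeff f d) * z ^ d)"
    by (simp add: \<alpha>_def N_def poly_altdef degree_map_poly coeff_map_poly)
  have "?A *\<^sub>v v = \<alpha> \<cdot>\<^sub>v v"
  proof (rule eq_vecI)
    fix i assume "i < dim_vec (\<alpha> \<cdot>\<^sub>v v)"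
    then have i: "i < n" by (simp add: v_def)
    have "(?A *\<^sub>v v) $ i = (\<Sum>j<n. of_int (A $$ (i, j)) * z ^ j)"
      using i A by (simp add: v_def scalar_prod_def atLeast0LessThan)
    also have "\<dots> = (\<Sum>j<n. \<Sum>d\<le>N. if (i + d) mod n = j then of_int (coeff f d) * z ^ j else 0)"
      using i by (intro sum.cong) (auto simp: A_def sum_distrib_right intro!: sum.cong)
    also have "\<dots> = (\<Sum>d\<le>N. \<Sum>j<n. if (i + d) mod n = j then of_int (coeff f d) * z ^ j else 0)"
      by (rule sum.swap)
    also have "\<dots> = (\<Sum>d\<le>N. of_int (coeff f d) * z ^ ((i + d) mod n))"
      using n by (intro sum.cong) simp_all
    also have "\<dots> = \<alpha> * z ^ i"
      unfolding alpha zmod by (simp add: sum_distrib_left power_add mult_ac)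
    finally show "(?A *\<^sub>v v) $ i = (\<alpha> \<cdot>\<^sub>v v) $ i" using i by (simp add: v_def)
  qed (simp add: v_def A_def)
  moreover have "v \<noteq> 0\<^sub>v n"
  proof
    assume "v = 0\<^sub>v n"
    then have "v $ 0 = 0" using n by simp
    then show False using n by (simp add: v_def)
  qed
  ultimately have "eigenvalue ?A \<alpha>"
    unfolding eigenvalue_def eigenvector_def using cA by (auto simp: v_def intro!: exI[of _ v])
  then have "poly (char_poly ?A) \<alpha> = 0" by (simp add: eigenvalue_root_char_poly[OF cA])
  then have "poly (map_poly of_int (char_poly A)) \<alpha> = 0" by (simp add: of_int_hom.char_poly_hom[OF A])
  moreover have "lead_coeff (char_poly A) = 1" using degree_monic_char_poly[OF A] by simp
  ultimately show ?thesis unfolding \<alpha>_def algebraic_int_altdef_ipoly by blast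
qed

text \<open>Otherwise 1/p would be a rational algebraic integer, hence an integer. This makes the
  ideal generated by p in \<int>[z] proper.\<close>

lemma inverse_prime_not_ipoly_eval_root_unity:
  assumes z: "z ^ n = 1" "n > 0" and p: "prime p"
  shows "of_nat p * ipoly_eval f z \<noteq> 1"
proof
  assume "of_nat p * ipoly_eval f z = 1"
  then have eq: "ipoly_eval f z = 1 / of_nat p" using p prime_gt_0_nat by (simp add: field_simps)
  then have "ipoly_eval f z \<in> \<rat>" by simp
  with algebraic_int_ipoly_eval_root_unity[OF z] have "ipoly_eval f z \<in> \<int>"
    by (rule rational_algebraic_int_is_int)
  then obtain k where "1 / of_nat p = (of_int k :: complex)" using eq by (auto elim!: Ints_cases)
  then have "of_int (k * int p) = (1 :: complex)" using p prime_gt_0_nat by (auto simp: field_simps)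
  then have "k * int p = 1" by (simp only: of_int_eq_1_iff)
  then have "int p dvd 1" by (metis dvd_triv_right)
  then show False using p by (simp add: prime_nat_iff)
qed

text \<open>Both sides are monic of degree n, so a nonzero difference would have degree below n but
  n roots.\<close>

lemma power_minus_1_roots_unity:
  fixes n :: nat
  assumes n: "n > 0"
  defines "z \<equiv> cis (2 * pi / real n)"
  shows "monom 1 n - 1 = (\<Prod>i<n. [:- (z ^ i), 1:])"
proof -
  let ?P = "monom 1 n - 1 :: complex poly" and ?Q = "(\<Prod>i<n. [:- (z ^ i), 1:])"
  have zi: "z ^ i = cis (2 * pi * real i / real n)" for i
    by (simp add: z_def Complex.DeMoivre mult_ac)
  have bij: "bij_betw (\<lambda>i. z ^ i) {..<n} {w. w ^ n = 1}"
    unfolding zi by (rule Complex.bij_betw_roots_unity[OF n])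
  then have inj: "inj_on (\<lambda>i. z ^ i) {..<n}" by (rule bij_betw_imp_inj_on)
  show ?thesis
  proof (rule ccontr)
    assume "?P \<noteq> ?Q"
    then have ne: "?P - ?Q \<noteq> 0" by simp
    have degQ: "degree ?Q = n" by (subst degree_prod_eq_sum_degree) auto
    have lcQ: "coeff ?Q n = 1" using degQ lead_coeff_prod[of "\<lambda>i. [:- (z ^ i), 1:]" "{..<n}"] by simp
    have degP: "degree ?P \<le> n" by (intro degree_diff_le) (auto simp: degree_monom_le)
    have "degree (?P - ?Q) \<le> n" using degree_diff_le[OF degP eq_refl[OF degQ]] .
    moreover have "coeff (?P - ?Q) n = 0" using lcQ n by simp
    ultimately have deg: "degree (?P - ?Q) < n"
      using ne by (metis le_neq_implies_less leading_coeff_0_iff)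
    have roots: "(\<lambda>i. z ^ i) ` {..<n} \<subseteq> {w. poly (?P - ?Q) w = 0}"
    proof
      fix w assume w: "w \<in> (\<lambda>i. z ^ i) ` {..<n}"
      then have "w ^ n = 1" using bij by (auto simp: bij_betw_def)
      moreover have "poly ?Q w = 0" using w by (auto simp: poly_prod)
      ultimately show "w \<in> {w. poly (?P - ?Q) w = 0}" by (simp add: poly_monom)
    qed
    have "n = card ((\<lambda>i. z ^ i) ` {..<n})" using inj by (simp add: card_image)
    also have "\<dots> \<le> card {w. poly (?P - ?Q) w = 0}"
      using poly_roots_finite[OF ne] roots by (rule card_mono)
    also have "\<dots> \<le> degree (?P - ?Q)" using ne by (rule card_poly_roots_bound)
    finally show False using deg by simp
  qed
qed

text \<open>Cancel X - 1 from X^n - 1 and evaluate at 1. For n = q - 1 the value is -1 modulo q,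
  which later keeps the powers of the root distinct in the residue field.\<close>

lemma prod_one_minus_roots_unity:
  fixes n :: nat
  assumes n: "n > 0"
  defines "z \<equiv> cis (2 * pi / real n)"
  shows "(\<Prod>i\<in>{1..<n}. 1 - z ^ i) = of_nat n"
proof -
  have "(\<Prod>i<n. [:- (z ^ i), 1:]) = [:-1, 1:] * (\<Prod>i\<in>{1..<n}. [:- (z ^ i), 1:])"
  proof -
    have "{..<n} = insert 0 {1..<n}" using n by auto
    then show ?thesis by simp
  qed
  moreover have "monom 1 n - 1 = [:-1, 1:] * (\<Sum>i<n. monom (1::complex) i)"
  proof -
    have "monom 1 k - 1 = [:-1, 1:] * (\<Sum>i<k. monom (1::complex) i)" for k
      by (induction k) (simp_all add: algebra_simps monom_Suc one_pCons)
    then show ?thesis .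
  qed
  ultimately have "[:-1, 1:] * (\<Prod>i\<in>{1..<n}. [:- (z ^ i), 1:]) = [:-1, 1:] * (\<Sum>i<n. monom (1::complex) i)"
    using power_minus_1_roots_unity[OF n] by (simp add: z_def)
  then have "(\<Prod>i\<in>{1..<n}. [:- (z ^ i), 1:]) = (\<Sum>i<n. monom (1::complex) i)"
    by (subst (asm) mult_cancel_left) simp
  then have "poly (\<Prod>i\<in>{1..<n}. [:- (z ^ i), 1:]) 1 = poly (\<Sum>i<n. monom (1::complex) i) 1" by simp
  then show ?thesis by (simp add: poly_prod poly_sum poly_monom)
qed

section \<open>The field of prime power order and the conclusion\<close>

text \<open>The field of order \<open>q = p\<^sup>k\<close> is realised as \<open>\<int>[\<zeta>]\<close> modulo a prime ideal containing \<open>p\<close>, where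
  \<open>\<zeta>\<close> is a primitive \<open>(q - 1)\<close>-th root of unity; it consists of the classes of 0 and the powers of \<open>\<zeta>\<close>.
  The ring \<open>\<int>[\<zeta>]\<close> is presented as a quotient of the integer polynomials.\<close>

lemma lines_of_finite_field:
  fixes q :: nat
  assumes "primepow q"
  obtains L :: "nat \<Rightarrow> nat \<Rightarrow> nat \<Rightarrow> nat" where "\<And>m c x. L m c x < q"
    "\<And>m x. inj_on (\<lambda>c. L m c x) {..<q}"
    "\<And>x x' y y'. x < q \<Longrightarrow> x' < q \<Longrightarrow> x \<noteq> x' \<Longrightarrow> y < q \<Longrightarrow> y' < q \<Longrightarrow>
      \<exists>m<q. \<exists>c<q. L m c x = y \<and> L m c x' = y'"
proof -
  obtain p k where p: "prime p" and k: "k > 0" and qpk: "q = p ^ k"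
    using assms by (auto simp: primepow_def)
  have q2: "q \<ge> 2" using primepow_gt_Suc_0[OF assms] by simp
  define n where "n = q - 1"
  have n: "n > 0" and qn: "q = Suc n" using q2 by (auto simp: n_def)
  define z where "z = cis (2 * pi / real n)"
  have zn: "z ^ n = 1" using n by (simp add: z_def Complex.DeMoivre)
  define ev where "ev f = ipoly_eval f z" for f
  have ev: "ev (f + g) = ev f + ev g" "ev (f - g) = ev f - ev g" "ev (f * g) = ev f * ev g"
    "ev (f ^ i) = ev f ^ i" "ev (\<Prod>i\<in>S. F i) = (\<Prod>i\<in>S. ev (F i))" for f g i and S :: "nat set" and F
    by (simp_all only: ev_def ipoly_eval_hom ipoly_eval_prod)
  have ev_of_nat: "ev (of_nat m) = of_nat m" for m by (induction m) (simp_all add: ev_def hom_distribs)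
  have ev_0: "ev 0 = 0" and ev_1: "ev 1 = 1" by (simp_all add: ev_def)
  define X :: "int poly" where "X = [:0, 1:]"
  have ev_X: "ev X = z" by (simp add: ev_def X_def)
  \<comment> \<open>The preimage of p \<int>[z]. Taking g = 0, it contains the kernel of
    \<open>ev\<close>, so identities in \<int>[z] become congruences modulo M.\<close>
  define I where "I = {f. \<exists>g. ev f = of_nat p * ev g}"
  have "comm_ring_ideal I"
  proof
    show "0 \<in> I" by (auto simp: I_def ev_0 intro: exI[of _ 0])
    fix x y assume "y \<in> I"
    then obtain g where g: "ev y = of_nat p * ev g" by (auto simp: I_def)
    then show "x * y \<in> I" by (auto simp: I_def ev intro!: exI[of _ "x * g"])
    assume "x \<in> I"
    then obtain h where "ev x = of_nat p * ev h" by (auto simp: I_def)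
    then show "x + y \<in> I" using g by (auto simp: I_def ev ring_distribs intro!: exI[of _ "h + g"])
  qed
  moreover have "1 \<notin> I"
    using inverse_prime_not_ipoly_eval_root_unity[OF zn n p] by (auto simp: I_def ev_1 ev_def[symmetric])
  ultimately obtain M where M: "comm_ring_ideal M" "I \<subseteq> M" "1 \<notin> M"
    and prime: "\<And>a b. a * b \<in> M \<Longrightarrow> a \<in> M \<or> b \<in> M"
    using prime_ideal_exists by blast
  interpret M: comm_ring_ideal M by (rule M(1))
  have ker: "f \<in> M" if "ev f = 0" for f
    using that M(2) by (auto simp: I_def ev_0 intro!: exI[of _ 0])
  have "ev (of_nat p) = of_nat p * ev 1" by (simp add: ev_of_nat ev_1)
  then have pM: "of_nat p \<in> M" using M(2) unfolding I_def by blast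
  have qM: "of_nat q \<in> M"
  proof -
    have "(of_nat q :: int poly) = of_nat (p ^ (k - 1)) * of_nat p"
      using k by (cases k) (simp_all add: qpk)
    then show ?thesis using M.mult_mem[OF pM] by metis
  qed
  have prime_prod: "\<exists>i\<in>S. F i \<in> M" if "finite S" "(\<Prod>i\<in>S. F i) \<in> M" for F :: "nat \<Rightarrow> int poly" and S
    using that
  proof (induction S rule: finite_induct)
    case empty
    then show ?case using M(3) by simp
  next
    case (insert i S)
    then have "F i * (\<Prod>i\<in>S. F i) \<in> M" by simp
    then show ?case using prime insert.IH by blast
  qed
  note frob = M.eqm_frobenius[OF p pM, of _ _ k, folded qpk]
  \<comment> \<open>Fermat's little theorem, adding 1 by means of \<open>frob\<close>; the downward
    step reaches the negative coefficients.\<close>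
  have frob_int: "M.eqm (of_int a ^ q) (of_int a)" for a
  proof (induction a rule: int_induct[where k = 0])
    case base
    then show ?case by (simp add: qn M.eqm_refl)
  next
    case (step1 i)
    have "M.eqm ((of_int i + 1) ^ q) (of_int i ^ q + 1)" using frob[of "of_int i" 1] by simp
    moreover have "M.eqm (of_int i ^ q + 1) (of_int i + 1)" by (intro M.eqm_add step1.IH M.eqm_refl)
    ultimately show ?case using M.eqm_trans by simp
  next
    case (step2 i)
    have "M.eqm (of_int i ^ q) (of_int (i - 1) ^ q + 1)" using frob[of "of_int (i - 1)" 1] by simp
    then have "M.eqm (of_int (i - 1) ^ q + 1) (of_int i)"
      using step2.IH M.eqm_sym M.eqm_trans by blast
    then show ?case by (simp add: M.eqm_def algebra_simps)
  qed
  have z_q: "z ^ q = z" by (simp add: qn zn)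
  have frob_id: "M.eqm (g ^ q) g" for g
  proof (induction g rule: pCons_induct)
    case 0
    then show ?case by (simp add: qn M.eqm_refl)
  next
    case (pCons a g)
    have eq: "pCons a g = of_int a + X * g" by (simp add: X_def of_int_poly)
    have "ev (X ^ q - X) = 0" by (simp add: ev ev_X z_q)
    then have "M.eqm (X ^ q) X" using ker by (simp add: M.eqm_def)
    then have "M.eqm (X ^ q * g ^ q) (X * g)" using pCons.IH by (rule M.eqm_mult)
    then have "M.eqm (of_int a ^ q + X ^ q * g ^ q) (of_int a + X * g)" by (rule M.eqm_add[OF frob_int])
    moreover have "M.eqm ((of_int a + X * g) ^ q) (of_int a ^ q + X ^ q * g ^ q)"
      using frob[of "of_int a" "X * g"] by (simp add: power_mult_distrib)
    ultimately show ?case unfolding eq using M.eqm_trans by blast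
  qed
  define T where "T i = (case i of 0 \<Rightarrow> 0 | Suc j \<Rightarrow> X ^ j)" for i
  have ex: "\<exists>i<q. g - T i \<in> M" for g
  proof -
    \<comment> \<open>Hence g^q - g = g (g^n - 1) factors modulo M into g and the g - X^i, and
      primality puts one factor in M.\<close>
    have "w ^ n - 1 = (\<Prod>i<n. w - z ^ i)" for w
      using arg_cong[OF power_minus_1_roots_unity[OF n], of "\<lambda>P. poly P w"]
      by (simp add: poly_prod poly_monom z_def)
    then have "ev (g * (\<Prod>i<n. g - X ^ i) - (g ^ q - g)) = 0"
      by (simp add: ev ev_X qn algebra_simps)
    then have "g * (\<Prod>i<n. g - X ^ i) - (g ^ q - g) + (g ^ q - g) \<in> M"
      using ker frob_id[of g] by (intro M.add_mem) (simp_all add: M.eqm_def)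
    then have "g \<in> M \<or> (\<Prod>i<n. g - X ^ i) \<in> M" using prime by simp
    then consider "g \<in> M" | i where "i < n" "g - X ^ i \<in> M" using prime_prod[of "{..<n}"] by auto
    then show ?thesis
    proof cases
      case 1
      then show ?thesis using q2 by (intro exI[of _ 0]) (auto simp: T_def)
    next
      case 2
      then show ?thesis using qn by (intro exI[of _ "Suc i"]) (auto simp: T_def)
    qed
  qed
  have X_pow: "X ^ j \<notin> M" if "j \<le> n" for j
  proof
    assume "X ^ j \<in> M"
    then have "X ^ (n - j) * X ^ j \<in> M" by (rule M.mult_mem)
    then have "X ^ n \<in> M" using that by (simp flip: power_add)
    moreover have "X ^ n - 1 \<in> M" by (rule ker) (simp add: ev ev_X ev_1 zn)
    ultimately have "X ^ n - (X ^ n - 1) \<in> M" by (rule M.diff_mem)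
    then show False using M(3) by simp
  qed
  \<comment> \<open>One factor in M would put the whole product, congruent to n, in M; with q in M
    this gives 1 = q - n in M.\<close>
  have X_ord: "1 - X ^ d \<notin> M" if d: "d \<in> {1..<n}" for d
  proof
    assume "1 - X ^ d \<in> M"
    then have "(\<Prod>i\<in>{1..<n} - {d}. 1 - X ^ i) * (1 - X ^ d) \<in> M" by (rule M.mult_mem)
    then have "(\<Prod>i\<in>{1..<n}. 1 - X ^ i) \<in> M" using d by (subst prod.remove[of _ d]) (simp_all add: mult.commute)
    moreover have "(\<Prod>i\<in>{1..<n}. 1 - X ^ i) - of_nat n \<in> M"
      using prod_one_minus_roots_unity[OF n] by (intro ker) (simp add: ev ev_1 ev_X ev_of_nat z_def)
    ultimately have "(\<Prod>i\<in>{1..<n}. 1 - X ^ i) - ((\<Prod>i\<in>{1..<n}. 1 - X ^ i) - of_nat n) \<in> M" by (rule M.diff_mem)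
    then have "of_nat n \<in> M" by simp
    then have "of_nat q - of_nat n \<in> M" by (rule M.diff_mem[OF qM])
    then show False using M(3) by (simp add: qn)
  qed
  have X_inj: "X ^ i - X ^ j \<notin> M" if "i < j" "j < n" for i j
  proof
    assume "X ^ i - X ^ j \<in> M"
    moreover have "X ^ i - X ^ j = X ^ i * (1 - X ^ (j - i))"
      using that by (simp add: algebra_simps flip: power_add)
    ultimately have "X ^ i \<in> M \<or> 1 - X ^ (j - i) \<in> M" using prime by simp
    moreover have "i \<le> n" "j - i \<in> {1..<n}" using that by auto
    ultimately show False using X_pow X_ord by blast
  qed
  have uniq: "i = j" if ij: "i < q" "j < q" "T i - T j \<in> M" for i j
  proof (rule ccontr)
    have neg: "T j - T i \<in> M" using M.uminus_mem[OF ij(3)] by simp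
    assume "i \<noteq> j"
    then show False
      using ij neg X_pow X_inj qn by (cases i; cases j) (auto simp: T_def linorder_neq_iff)
  qed
  show thesis
    using lines_of_residue_field[OF M(1) prime q2 _ ex uniq] frob_id that by (simp add: M.eqm_def) blast
qed

lemma projective_plane_hypergraph_primepow:
  fixes r w :: nat
  assumes r: "primepow (r - 1)" and w: "w \<le> r^2 - r"
  shows "\<exists>(V::nat set) E. uniform_hypergraph r V E \<and> nice V E \<and> \<not> strongly_weighted w E"
proof -
  define q where "q = r - 1"
  have q: "q \<ge> 2" and rq: "r = q + 1" using primepow_gt_Suc_0[OF r] by (auto simp: q_def)
  obtain L :: "nat \<Rightarrow> nat \<Rightarrow> nat \<Rightarrow> nat" where L: "\<And>m c x. L m c x < q"
    "\<And>m x. inj_on (\<lambda>c. L m c x) {..<q}"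
    "\<And>x x' y y'. x < q \<Longrightarrow> x' < q \<Longrightarrow> x \<noteq> x' \<Longrightarrow> y < q \<Longrightarrow> y' < q \<Longrightarrow>
      \<exists>m<q. \<exists>c<q. L m c x = y \<and> L m c x' = y'"
    using lines_of_finite_field[OF r[folded q_def]] by blast
  have "r^2 - r = q^2 + q" by (simp add: rq power2_eq_square)
  then show ?thesis
    using projective_plane_hypergraph[of q w L] q L w rq by simp
qed

theorem theorem1p1:
  shows "(\<forall>r::nat. r \<ge> 3 \<longrightarrow> primepow (r - 1) \<longrightarrow>
            (\<exists>(V::nat set) E. uniform_hypergraph r V E \<and> nice V E \<and>
               \<not> strongly_weighted (r^2 - r) E))
       \<and> (\<exists>g::nat \<Rightarrow> nat. ((\<lambda>r. real (g r) / real r ^ 2) \<longlongrightarrow> 0) at_top \<and>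
            (\<forall>\<^sub>F r in at_top. \<exists>(V::nat set) E. uniform_hypergraph r V E \<and> nice V E \<and>
               \<not> strongly_weighted (r^2 - g r) E))
       \<and> (\<forall>r::nat. r \<ge> 3 \<longrightarrow>
            (\<exists>(V::nat set) E. uniform_hypergraph r V E \<and> \<not> weakly_weighted 2 E))"
  using projective_plane_hypergraph_primepow asymptotically_optimal_hypergraphs
    single_edge_not_weakly_weighted by blast

end
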